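(* For any functor $M:\mathbf{ZZ}\to\mathbf{set}$, $$\mathrm{Full}(M)=\mathrm{rk}_{\mathbf{vec}}(L_{\mathbb{F}}\circ M)$$ as functions $\mathbf{Int}(\mathbf{ZZ})\to\mathbb{Z}_{\ge0}$.
   Context: $\mathbf{set}$ is the category of finite sets; $\mathbf{vec}$ (resp. $\mathbf{Vec}$) is the category of finite-dimensional (resp. all) vector spaces over a fixed field $\mathbb{F}$. $L_{\mathbb{F}}:\mathbf{Set}\to\mathbf{Vec}$ is the free vector space functor (it sends $\mathbf{set}$ to $\mathbf{vec}$). $\mathbf{ZZ}=\{(i,j)\in\mathbb{Z}^2: j=i\text{ or }j=i-1\}$ with the order inherited from $\mathbb{R}^{\mathrm{op}}\times\mathbb{R}$; thus the nontrivial relations are $(i,i-1)\le(i,i)$ and $(i,i-1)\le(i-1,i-1)$, $i\in\mathbb{Z}$. $\mathbf{Int}(\mathbf{ZZ})$ is the collection of intervals of $\mathbf{ZZ}$: nonempty subsets that are connected (any two elements joined by a finite sequence of consecutively comparable elements of the subset) and convex. For $I\in\mathbf{Int}(\mathbf{ZZ})$ and $N:I\to\mathbf{set}$ with colimit (in $\mathbf{Set}$) $(\varinjlim N,(i_k)_{k\in I})$, the support of $c\in\varinjlim N$ is $\mathrm{supp}(c)=\{k\in I:\exists x_k\in N_k,\ i_k(x_k)=c\}$, and $c$ is a full component of $N$ if $\mathrm{supp}(c)=I$. $\mathrm{full}(N)$ is the number of full components of $N$. The full function $\mathrm{Full}(M):\mathbf{Int}(\mathbf{ZZ})\to\mathbb{Z}_{\ge0}$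 is $I\mapsto\mathrm{full}(M|_I)$. For $G:\mathbf{ZZ}\to\mathbf{vec}$ and $I\in\mathbf{Int}(\mathbf{ZZ})$, $\mathrm{rk}_{\mathbf{vec}}(G)(I)$ is the rank (dimension of the image) of the canonical map $\varprojlim G|_I\to\varinjlim G|_I$ in $\mathbf{Vec}$, i.e. the composite $\varprojlim G|_I\to G_a\to\varinjlim G|_I$ for any $a\in I$ (independent of $a$). *)

theory Defs
  imports Complex_Main "HOL-Library.FuncSet" "HOL-Library.Poly_Mapping"
begin

section \<open>The zigzag poset and its intervals\<close>

typedef zz = "{(i :: int, j :: int). j = i \<or> j = i - 1}"
  by (rule exI[of _ "(0, 0)"]) simp

text \<open>The order is inherited from \<open>\<real>\<^sup>o\<^sup>p \<times> \<real>\<close>, so the first coordinate is reversed.\<close>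

instantiation zz :: order
begin

definition less_eq_zz :: "zz \<Rightarrow> zz \<Rightarrow> bool" where
  "p \<le> q \<longleftrightarrow> fst (Rep_zz q) \<le> fst (Rep_zz p) \<and> snd (Rep_zz p) \<le> snd (Rep_zz q)"

definition less_zz :: "zz \<Rightarrow> zz \<Rightarrow> bool" where
  "(p :: zz) < q \<longleftrightarrow> p \<le> q \<and> \<not> q \<le> p"

instance
proof
  fix p q :: zz
  assume "p \<le> q" "q \<le> p"
  then have "Rep_zz p = Rep_zz q"
    by (auto simp: less_eq_zz_def prod_eq_iff)
  then show "p = q"
    by (simp add: Rep_zz_inject)
qed (auto simp: less_eq_zz_def less_zz_def)

end

lemma zz_le_iff:
  fixes i j i' j' :: int
  assumes "j = i \<or> j = i - 1" "j' = i' \<or> j' = i' - 1"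
  shows "Abs_zz (i, j) \<le> Abs_zz (i', j') \<longleftrightarrow>
    (i, j) = (i', j') \<or> j = i - 1 \<and> ((i', j') = (i, i) \<or> (i', j') = (i - 1, i - 1))"
  using assms by (auto simp: less_eq_zz_def Abs_zz_inverse)

definition order_convex :: "'p::order set \<Rightarrow> bool" where
  "order_convex I \<longleftrightarrow> (\<forall>a\<in>I. \<forall>c\<in>I. \<forall>b. a \<le> b \<and> b \<le> c \<longrightarrow> b \<in> I)"

definition order_connected :: "'p::order set \<Rightarrow> bool" where
  "order_connected I \<longleftrightarrow>
     (\<forall>a\<in>I. \<forall>b\<in>I. (\<lambda>x y. x \<in> I \<and> y \<in> I \<and> (x \<le> y \<or> y \<le> x))\<^sup>*\<^sup>* a b)"

definition intervals :: "'p::order set set" where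
  "intervals = {I. I \<noteq> {} \<and> order_connected I \<and> order_convex I}"


section \<open>Diagrams over a poset\<close>

text \<open>
  A diagram \<open>G\<close> assigns to \<open>k\<close> the carrier set \<open>Obj G k\<close> and to \<open>k \<le> l\<close> the map \<open>Hom G k l\<close>,
  of which only the values on \<open>Obj G k\<close> matter.  All carriers lie in one ambient type.  A set \<open>I\<close>
  of indices passed together with a diagram stands for the restriction of the diagram to \<open>I\<close>.
\<close>

record ('p, 'a) diagram =
  Obj :: "'p \<Rightarrow> 'a set"
  Hom :: "'p \<Rightarrow> 'p \<Rightarrow> 'a \<Rightarrow> 'a"

definition functor_to_sets :: "('p::order, 'a) diagram \<Rightarrow> bool" where
  "functor_to_sets M \<longleftrightarrow>
     (\<forall>k l. k \<le> l \<longrightarrow> Hom M k l \<in> Obj M k \<rightarrow> Obj M l) \<and>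
     (\<forall>k. \<forall>x\<in>Obj M k. Hom M k k x = x) \<and>
     (\<forall>k l m. k \<le> l \<and> l \<le> m \<longrightarrow> (\<forall>x\<in>Obj M k. Hom M l m (Hom M k l x) = Hom M k m x))"

definition functor_to_finite_sets :: "('p::order, 'a) diagram \<Rightarrow> bool" where
  "functor_to_finite_sets M \<longleftrightarrow> functor_to_sets M \<and> (\<forall>k. finite (Obj M k))"


section \<open>Colimits in sets and full components\<close>

text \<open>The colimit is the disjoint union modulo the equivalence relation generated by \<open>colim_rel\<close>.\<close>

definition colim_rel :: "'p::order set \<Rightarrow> ('p, 'a) diagram \<Rightarrow> 'p \<times> 'a \<Rightarrow> 'p \<times> 'a \<Rightarrow> bool" where
  "colim_rel I N u v \<longleftrightarrow> u \<in> Sigma I (Obj N) \<and> v \<in> Sigma I (Obj N) \<and>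
     fst u \<le> fst v \<and> snd v = Hom N (fst u) (fst v) (snd u)"

definition colim_set :: "'p::order set \<Rightarrow> ('p, 'a) diagram \<Rightarrow> ('p \<times> 'a) set set" where
  "colim_set I N = Sigma I (Obj N) // {(u, v). equivclp (colim_rel I N) u v}"

definition colim_set_in :: "'p::order set \<Rightarrow> ('p, 'a) diagram \<Rightarrow> 'p \<Rightarrow> 'a \<Rightarrow> ('p \<times> 'a) set" where
  "colim_set_in I N k x = {v. equivclp (colim_rel I N) (k, x) v}"

definition supp :: "'p::order set \<Rightarrow> ('p, 'a) diagram \<Rightarrow> ('p \<times> 'a) set \<Rightarrow> 'p set" where
  "supp I N c = {k \<in> I. \<exists>x\<in>Obj N k. colim_set_in I N k x = c}"

definition full_components :: "'p::order set \<Rightarrow> ('p, 'a) diagram \<Rightarrow> ('p \<times> 'a) set set" where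
  "full_components I N = {c \<in> colim_set I N. supp I N c = I}"

definition Full :: "('p::order, 'a) diagram \<Rightarrow> 'p set \<Rightarrow> nat" where
  "Full M I = card (full_components I M)"

lemma finite_full_components:
  assumes "functor_to_finite_sets M" "I \<noteq> {}"
  shows "finite (full_components I M)"
proof -
  obtain a where a: "a \<in> I"
    using assms(2) by blast
  have "full_components I M \<subseteq> colim_set_in I M a ` Obj M a"
  proof
    fix c assume "c \<in> full_components I M"
    then have "a \<in> supp I M c"
      using a by (simp add: full_components_def)
    then show "c \<in> colim_set_in I M a ` Obj M a"
      by (auto simp: supp_def)
  qed
  then show ?thesis
    using assms(1) by (auto simp: functor_to_finite_sets_def intro: finite_subset)
qed


section \<open>Diagrams of vector spaces\<close>

text \<open>
  A vector space is a subspace of an ambient space with scalar multiplication \<open>s\<close>.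
\<close>

definition linear_on ::
    "('f::field \<Rightarrow> 'v::ab_group_add \<Rightarrow> 'v) \<Rightarrow> ('f \<Rightarrow> 'w::ab_group_add \<Rightarrow> 'w) \<Rightarrow> 'v set \<Rightarrow> ('v \<Rightarrow> 'w) \<Rightarrow> bool" where
  "linear_on s t V f \<longleftrightarrow>
     (\<forall>x\<in>V. \<forall>y\<in>V. f (x + y) = f x + f y) \<and> (\<forall>c. \<forall>x\<in>V. f (s c x) = t c (f x))"

definition functor_to_Vec ::
    "('f::field \<Rightarrow> 'v::ab_group_add \<Rightarrow> 'v) \<Rightarrow> ('p::order, 'v) diagram \<Rightarrow> bool" where
  "functor_to_Vec s G \<longleftrightarrow> functor_to_sets G \<and>
     (\<forall>k. module.subspace s (Obj G k)) \<and>
     (\<forall>k l. k \<le> l \<longrightarrow> linear_on s s (Obj G k) (Hom G k l))"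

definition functor_to_vec ::
    "('f::field \<Rightarrow> 'v::ab_group_add \<Rightarrow> 'v) \<Rightarrow> ('p::order, 'v) diagram \<Rightarrow> bool" where
  "functor_to_vec s G \<longleftrightarrow> functor_to_Vec s G \<and>
     (\<forall>k. \<exists>B. finite B \<and> Obj G k = module.span s B)"

definition pm_scale :: "('f \<Rightarrow> 'v \<Rightarrow> 'v) \<Rightarrow> 'f \<Rightarrow> ('k \<Rightarrow>\<^sub>0 'v::zero) \<Rightarrow> ('k \<Rightarrow>\<^sub>0 'v)" where
  "pm_scale s c = Poly_Mapping.map (s c)"

lemma lookup_pm_scale:
  assumes "vector_space s"
  shows "Poly_Mapping.lookup (pm_scale s c p) k = s c (Poly_Mapping.lookup p k)"
proof -
  interpret vector_space s by fact
  show ?thesis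
    by (simp add: pm_scale_def map.rep_eq when_def)
qed

lemma vector_space_pm_scale:
  assumes "vector_space s"
  shows "vector_space (pm_scale s)"
proof -
  interpret vector_space s by fact
  show ?thesis
    by unfold_locales
      (auto intro!: poly_mapping_eqI
        simp: lookup_pm_scale[OF assms] lookup_add scale_right_distrib scale_left_distrib)
qed

lemma vector_space_field: "vector_space ((*) :: 'f::field \<Rightarrow> 'f \<Rightarrow> 'f)"
  by unfold_locales (auto simp: algebra_simps)


subsection \<open>The free vector space functor\<close>

abbreviation free_scale :: "'f::field \<Rightarrow> ('a \<Rightarrow>\<^sub>0 'f) \<Rightarrow> ('a \<Rightarrow>\<^sub>0 'f)" where
  "free_scale \<equiv> pm_scale (*)"

definition free_space :: "'a set \<Rightarrow> ('a \<Rightarrow>\<^sub>0 'f::field) set" where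
  "free_space X = {p. Poly_Mapping.keys p \<subseteq> X}"

definition free_map :: "('a \<Rightarrow> 'b) \<Rightarrow> ('a \<Rightarrow>\<^sub>0 'f::field) \<Rightarrow> ('b \<Rightarrow>\<^sub>0 'f)" where
  "free_map f p = (\<Sum>x\<in>Poly_Mapping.keys p. Poly_Mapping.single (f x) (Poly_Mapping.lookup p x))"

text \<open>The composite \<open>L \<circ> M\<close> of a diagram of sets with the free vector space functor.\<close>

definition free_diagram :: "('p, 'a) diagram \<Rightarrow> ('p, 'a \<Rightarrow>\<^sub>0 'f::field) diagram" where
  "free_diagram M =
     \<lparr>Obj = (\<lambda>k. free_space (Obj M k)), Hom = (\<lambda>k l. free_map (Hom M k l))\<rparr>"


subsection \<open>Limits and colimits of vector spaces\<close>

definition lim_vec :: "'p::order set \<Rightarrow> ('p, 'v::zero) diagram \<Rightarrow> ('p \<Rightarrow> 'v) set" where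
  "lim_vec I G = {x. (\<forall>k\<in>I. x k \<in> Obj G k) \<and> (\<forall>k. k \<notin> I \<longrightarrow> x k = 0) \<and>
     (\<forall>k\<in>I. \<forall>l\<in>I. k \<le> l \<longrightarrow> Hom G k l (x k) = x l)}"

text \<open>
  A linear map with kernel \<open>R\<close> is, onto its image, a quotient map by \<open>R\<close>.  Realising the quotient
  inside the ambient space makes the library notion of dimension applicable to its subspaces.
  The colimit is the direct sum modulo the span of \<open>v - Hom G k l v\<close>; that it has the universal
  property is \<open>colim_vec_universal\<close> below.
\<close>

definition quotient_map ::
    "('f::field \<Rightarrow> 'v::ab_group_add \<Rightarrow> 'v) \<Rightarrow> 'v set \<Rightarrow> 'v \<Rightarrow> 'v" where
  "quotient_map s R = (SOME q. Vector_Spaces.linear s s q \<and> {x. q x = 0} = R)"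

definition direct_sum :: "'p set \<Rightarrow> ('p, 'v::zero) diagram \<Rightarrow> ('p \<Rightarrow>\<^sub>0 'v) set" where
  "direct_sum I G = {d. Poly_Mapping.keys d \<subseteq> I \<and> (\<forall>k\<in>I. Poly_Mapping.lookup d k \<in> Obj G k)}"

definition colim_relations ::
    "('f::field \<Rightarrow> 'v::ab_group_add \<Rightarrow> 'v) \<Rightarrow> 'p::order set \<Rightarrow> ('p, 'v) diagram \<Rightarrow> ('p \<Rightarrow>\<^sub>0 'v) set" where
  "colim_relations s I G = module.span (pm_scale s)
     {Poly_Mapping.single k v - Poly_Mapping.single l (Hom G k l v) | k l v.
        k \<in> I \<and> l \<in> I \<and> k \<le> l \<and> v \<in> Obj G k}"

definition colim_vec ::
    "('f::field \<Rightarrow> 'v::ab_group_add \<Rightarrow> 'v) \<Rightarrow> 'p::order set \<Rightarrow> ('p, 'v) diagram \<Rightarrow> ('p \<Rightarrow>\<^sub>0 'v) set" where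
  "colim_vec s I G = quotient_map (pm_scale s) (colim_relations s I G) ` direct_sum I G"

definition colim_vec_in ::
    "('f::field \<Rightarrow> 'v::ab_group_add \<Rightarrow> 'v) \<Rightarrow> 'p::order set \<Rightarrow> ('p, 'v) diagram \<Rightarrow> 'p \<Rightarrow> 'v \<Rightarrow> ('p \<Rightarrow>\<^sub>0 'v)" where
  "colim_vec_in s I G k v =
     quotient_map (pm_scale s) (colim_relations s I G) (Poly_Mapping.single k v)"

text \<open>
  The canonical map is defined through an arbitrary index; by \<open>canonical_map_eq\<close> below the choice
  does not matter.
\<close>

definition canonical_map ::
    "('f::field \<Rightarrow> 'v::ab_group_add \<Rightarrow> 'v) \<Rightarrow> 'p::order set \<Rightarrow> ('p, 'v) diagram \<Rightarrow> ('p \<Rightarrow> 'v) \<Rightarrow> ('p \<Rightarrow>\<^sub>0 'v)" where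
  "canonical_map s I G x = (let a = (SOME a. a \<in> I) in colim_vec_in s I G a (x a))"

definition rk_vec ::
    "('f::field \<Rightarrow> 'v::ab_group_add \<Rightarrow> 'v) \<Rightarrow> ('p::order, 'v) diagram \<Rightarrow> 'p set \<Rightarrow> nat" where
  "rk_vec s G I = vector_space.dim (pm_scale s) (canonical_map s I G ` lim_vec I G)"


subsection \<open>Correctness of the constructions\<close>

lemma quotient_map:
  assumes "vector_space s" "module.subspace s R"
  shows "Vector_Spaces.linear s s (quotient_map s R)" "quotient_map s R x = 0 \<longleftrightarrow> x \<in> R"
proof -
  interpret vector_space s by fact
  interpret pair: vector_space_pair s s ..
  obtain B where B: "B \<subseteq> R" "independent B" "R \<subseteq> span B"
    using maximal_independent_subset by metis
  have R: "span B = R"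
    using B assms(2) span_minimal by blast
  define E where "E = extend_basis B"
  have E: "independent E" "B \<subseteq> E" "span E = UNIV"
    unfolding E_def using B(2) independent_extend_basis extend_basis_superset span_extend_basis by auto
  define q where "q = pair.construct E (\<lambda>b. if b \<in> B then 0 else b)"
  have lin: "Vector_Spaces.linear s s q"
    unfolding q_def using E(1) by (rule pair.linear_construct)
  interpret q: Vector_Spaces.linear s s q by fact
  have qE: "q b = (if b \<in> B then 0 else b)" if "b \<in> E" for b
    using that unfolding q_def by (simp add: pair.construct_basis[OF E(1)])
  have qC: "q x = x" if "x \<in> span (E - B)" for x
  proof (rule pair.linear_eq_on[OF lin _ that])
    show "Vector_Spaces.linear s s (\<lambda>x. x)" by (rule linear_ident)
  qed (simp add: qE)
  have qB: "q x = 0" if "x \<in> span B" for x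
    by (rule pair.linear_eq_on[OF lin pair.linear_zero that]) (use E(2) qE in auto)
  have "q x = 0 \<longleftrightarrow> x \<in> R" for x
  proof
    assume q0: "q x = 0"
    have "x \<in> span ((E - B) \<union> B)"
      using E by (simp add: Un_absorb2)
    then obtain u v where uv: "x = u + v" "u \<in> span (E - B)" "v \<in> span B"
      unfolding span_Un by auto
    then have "u = 0"
      using q0 qB qC by (simp add: q.add)
    then show "x \<in> R"
      using uv R by simp
  qed (use qB R in auto)
  then have "\<exists>q. Vector_Spaces.linear s s q \<and> {x. q x = 0} = R"
    using lin by blast
  then have "Vector_Spaces.linear s s (quotient_map s R) \<and> {x. quotient_map s R x = 0} = R"
    unfolding quotient_map_def by (rule someI_ex)
  then show "Vector_Spaces.linear s s (quotient_map s R)" "quotient_map s R x = 0 \<longleftrightarrow> x \<in> R"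
    by auto
qed

lemma linear_on_extend:
  assumes "vector_space s" "vector_space t" "module.subspace s V" "linear_on s t V f"
  shows "\<exists>g. Vector_Spaces.linear s t g \<and> (\<forall>x\<in>V. g x = f x)"
proof -
  interpret v: vector_space s by fact
  interpret w: vector_space t by fact
  interpret pair: vector_space_pair s t ..
  obtain B where B: "B \<subseteq> V" "v.independent B" "V \<subseteq> v.span B"
    using v.maximal_independent_subset by metis
  define g where "g = pair.construct B f"
  have lin: "Vector_Spaces.linear s t g"
    unfolding g_def using B(2) by (rule pair.linear_construct)
  interpret g: Vector_Spaces.linear s t g by fact
  have f0: "f 0 = 0"
    using assms(3,4) v.subspace_0 unfolding linear_on_def
    by (metis v.scale_zero_left w.scale_zero_left)
  have "x \<in> V \<and> g x = f x" if "x \<in> v.span B" for x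
    using that
  proof (induction rule: v.span_induct_alt)
    case base
    then show ?case using f0 v.subspace_0[OF assms(3)] g.zero by simp
  next
    case (step c b x)
    have "g b = f b"
      unfolding g_def using pair.construct_basis[OF B(2)] step by blast
    then show ?case
      using step B(1) assms(4) v.subspace_add[OF assms(3)] v.subspace_scale[OF assms(3)]
      by (auto simp: linear_on_def g.add g.scale)
  qed
  then show ?thesis
    using lin B(3) by blast
qed

lemma linear_colim_vec_in:
  assumes "vector_space s"
  shows "Vector_Spaces.linear s (pm_scale s) (colim_vec_in s I G k)"
proof -
  interpret v: vector_space s by fact
  interpret d: vector_space "pm_scale s"
    by (rule vector_space_pm_scale) fact
  interpret pair: vector_space_pair s "pm_scale s" ..
  interpret q: Vector_Spaces.linear "pm_scale s" "pm_scale s"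
      "quotient_map (pm_scale s) (colim_relations s I G)"
    using assms by (intro quotient_map vector_space_pm_scale)
      (simp_all add: colim_relations_def d.subspace_span)
  have *: "Poly_Mapping.single k (s c v) = pm_scale s c (Poly_Mapping.single k v)" for c v
    by (rule poly_mapping_eqI) (simp add: lookup_pm_scale[OF assms] lookup_single when_def)
  show ?thesis
    unfolding Vector_Spaces.linear_iff
    by (simp add: v.vector_space_axioms d.vector_space_axioms colim_vec_in_def single_add q.add q.scale *)
qed

lemma colim_vec_in_compatible:
  assumes "vector_space s" "k \<in> I" "l \<in> I" "k \<le> l" "v \<in> Obj G k"
  shows "colim_vec_in s I G l (Hom G k l v) = colim_vec_in s I G k v"
proof -
  interpret d: vector_space "pm_scale s"
    by (rule vector_space_pm_scale) fact
  have sub: "d.subspace (colim_relations s I G)"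
    by (simp add: colim_relations_def d.subspace_span)
  interpret q: Vector_Spaces.linear "pm_scale s" "pm_scale s"
      "quotient_map (pm_scale s) (colim_relations s I G)"
    using assms(1) sub by (intro quotient_map vector_space_pm_scale)
  have "Poly_Mapping.single k v - Poly_Mapping.single l (Hom G k l v) \<in> colim_relations s I G"
    unfolding colim_relations_def using assms by (intro d.span_base) blast
  then have "quotient_map (pm_scale s) (colim_relations s I G)
      (Poly_Mapping.single k v - Poly_Mapping.single l (Hom G k l v)) = 0"
    using quotient_map(2)[OF vector_space_pm_scale[OF assms(1)] sub] by blast
  then show ?thesis
    by (simp add: colim_vec_in_def q.diff)
qed

lemma poly_mapping_eq_sum_single: "d = (\<Sum>k\<in>Poly_Mapping.keys d. Poly_Mapping.single k (Poly_Mapping.lookup d k))"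
  by (rule poly_mapping_eqI)
    (auto simp: lookup_sum lookup_single when_def in_keys_iff)

text \<open>The universal property of the colimit in vector spaces.\<close>

theorem colim_vec_universal:
  fixes t :: "'f::field \<Rightarrow> 'w::ab_group_add \<Rightarrow> 'w"
    and G :: "('p::order, 'v::ab_group_add) diagram"
  assumes s: "vector_space s" and t: "vector_space t" and G: "functor_to_Vec s G"
    and h: "\<And>k. k \<in> I \<Longrightarrow> linear_on s t (Obj G k) (h k)"
    and compat: "\<And>k l v. k \<in> I \<Longrightarrow> l \<in> I \<Longrightarrow> k \<le> l \<Longrightarrow> v \<in> Obj G k \<Longrightarrow>
      h l (Hom G k l v) = h k v"
  shows "\<exists>H. Vector_Spaces.linear (pm_scale s) t H \<and>
      (\<forall>k\<in>I. \<forall>v\<in>Obj G k. H (colim_vec_in s I G k v) = h k v)" (is ?existence)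
    and "\<And>H H'. linear_on (pm_scale s) t (colim_vec s I G) H \<Longrightarrow>
      linear_on (pm_scale s) t (colim_vec s I G) H' \<Longrightarrow>
      (\<And>k v. k \<in> I \<Longrightarrow> v \<in> Obj G k \<Longrightarrow>
        H (colim_vec_in s I G k v) = H' (colim_vec_in s I G k v)) \<Longrightarrow>
      c \<in> colim_vec s I G \<Longrightarrow> H c = H' c"
proof -
  interpret v: vector_space s by fact
  interpret w: vector_space t by fact
  interpret d: vector_space "pm_scale s"
    by (rule vector_space_pm_scale) fact
  interpret vd: vector_space_pair s "pm_scale s" ..
  interpret dd: vector_space_pair "pm_scale s" "pm_scale s" ..
  interpret dw: vector_space_pair "pm_scale s" t ..
  interpret vw: vector_space_pair s t ..
  define R where "R = colim_relations s I G"
  define q where "q = quotient_map (pm_scale s) R"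
  have sub: "d.subspace R"
    by (simp add: R_def colim_relations_def d.subspace_span)
  have q: "Vector_Spaces.linear (pm_scale s) (pm_scale s) q" and q0: "\<And>x. q x = 0 \<longleftrightarrow> x \<in> R"
    using quotient_map[OF vector_space_pm_scale[OF s] sub] by (auto simp: q_def)
  interpret q: Vector_Spaces.linear "pm_scale s" "pm_scale s" q by fact
  have subG: "v.subspace (Obj G k)" for k
    using G by (simp add: functor_to_Vec_def)
  have in_q: "colim_vec_in s I G k v = q (Poly_Mapping.single k v)" for k v
    by (simp add: colim_vec_in_def q_def R_def)

  have "\<forall>k. \<exists>g. k \<in> I \<longrightarrow> Vector_Spaces.linear s t g \<and> (\<forall>x\<in>Obj G k. g x = h k x)"
    using linear_on_extend[OF s t subG h] by blast
  then obtain g where g: "\<And>k. k \<in> I \<Longrightarrow> Vector_Spaces.linear s t (g k)"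
      and gh: "\<And>k x. k \<in> I \<Longrightarrow> x \<in> Obj G k \<Longrightarrow> g k x = h k x"
    by metis
  define S :: "('p \<Rightarrow>\<^sub>0 'v) \<Rightarrow> 'w" where "S x = (\<Sum>k\<in>Poly_Mapping.keys x \<inter> I. g k (Poly_Mapping.lookup x k))" for x
  have S_eq: "S x = (\<Sum>k\<in>K \<inter> I. g k (Poly_Mapping.lookup x k))" if "finite K" "Poly_Mapping.keys x \<subseteq> K" for x K
    unfolding S_def
  proof (rule sum.mono_neutral_left)
    show "\<forall>k\<in>K \<inter> I - Poly_Mapping.keys x \<inter> I. g k (Poly_Mapping.lookup x k) = 0"
      using g vw.linear_0 by (auto simp: in_keys_iff)
  qed (use that in auto)
  have S: "Vector_Spaces.linear (pm_scale s) t S"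
    unfolding Vector_Spaces.linear_iff
  proof (intro conjI allI)
    show "vector_space (pm_scale s)" "vector_space t"
      by unfold_locales
  next
    fix x y :: "'p \<Rightarrow>\<^sub>0 'v"
    let ?K = "Poly_Mapping.keys x \<union> Poly_Mapping.keys y"
    have "S (x + y) = (\<Sum>k\<in>?K \<inter> I. g k (Poly_Mapping.lookup (x + y) k))"
      by (rule S_eq) (auto simp: keys_add)
    also have "\<dots> = (\<Sum>k\<in>?K \<inter> I. g k (Poly_Mapping.lookup x k) + g k (Poly_Mapping.lookup y k))"
      by (rule sum.cong) (auto simp: lookup_add vw.linear_add[OF g])
    also have "\<dots> = S x + S y"
      by (simp add: sum.distrib S_eq[of ?K])
    finally show "S (x + y) = S x + S y" .
  next
    fix c x
    have "S (pm_scale s c x) = (\<Sum>k\<in>Poly_Mapping.keys x \<inter> I. g k (Poly_Mapping.lookup (pm_scale s c x) k))"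
      by (rule S_eq) (auto simp: in_keys_iff lookup_pm_scale[OF s])
    also have "\<dots> = (\<Sum>k\<in>Poly_Mapping.keys x \<inter> I. t c (g k (Poly_Mapping.lookup x k)))"
      by (rule sum.cong) (auto simp: lookup_pm_scale[OF s] vw.linear_scale[OF g])
    finally show "S (pm_scale s c x) = t c (S x)"
      by (simp add: S_def w.scale_sum_right)
  qed
  interpret S: Vector_Spaces.linear "pm_scale s" t S by fact
  have S_single: "S (Poly_Mapping.single k v) = g k v" if "k \<in> I" for k v
    using S_eq[of "{k}" "Poly_Mapping.single k v"] that by simp
  have S_R: "S x = 0" if "x \<in> R" for x
  proof (rule dw.linear_eq_on[OF S dw.linear_zero that[unfolded R_def colim_relations_def]])
    fix b assume "b \<in> {Poly_Mapping.single k v - Poly_Mapping.single l (Hom G k l v) | k l v.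
        k \<in> I \<and> l \<in> I \<and> k \<le> l \<and> v \<in> Obj G k}"
    then obtain k l v where b: "b = Poly_Mapping.single k v - Poly_Mapping.single l (Hom G k l v)"
        and kl: "k \<in> I" "l \<in> I" "k \<le> l" "v \<in> Obj G k"
      by blast
    have "Hom G k l v \<in> Obj G l"
      using G kl by (auto simp: functor_to_Vec_def functor_to_sets_def)
    then show "S b = 0"
      using kl by (simp add: b S.diff S_single gh compat)
  qed
  obtain r where r: "Vector_Spaces.linear (pm_scale s) (pm_scale s) r"
      "\<And>y. y \<in> q ` UNIV \<Longrightarrow> q (r y) = y"
    using dd.linear_exists_right_inverse_on[OF q d.subspace_UNIV] by blast
  have Sr: "S (r (q x)) = S x" for x
  proof -
    have "q (x - r (q x)) = 0"
      by (simp add: q.diff r(2))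
    then have "S (x - r (q x)) = 0"
      using q0 S_R by blast
    then show ?thesis
      by (simp add: S.diff)
  qed
  have "Vector_Spaces.linear (pm_scale s) t (S \<circ> r)"
    using r(1) S by (rule Vector_Spaces.linear_compose)
  moreover have "(S \<circ> r) (colim_vec_in s I G k v) = h k v" if "k \<in> I" "v \<in> Obj G k" for k v
    using that by (simp add: in_q Sr S_single gh)
  ultimately show ?existence
    by blast

  fix H H'
  assume H: "linear_on (pm_scale s) t (colim_vec s I G) H"
    and H': "linear_on (pm_scale s) t (colim_vec s I G) H'"
    and eq: "\<And>k v. k \<in> I \<Longrightarrow> v \<in> Obj G k \<Longrightarrow>
        H (colim_vec_in s I G k v) = H' (colim_vec_in s I G k v)"
    and c: "c \<in> colim_vec s I G"
  have dir: "d.subspace (direct_sum I G)"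
  proof (rule d.subspaceI)
    show "0 \<in> direct_sum I G"
      using v.subspace_0[OF subG] by (simp add: direct_sum_def)
  next
    fix x y assume "x \<in> direct_sum I G" "y \<in> direct_sum I G"
    then show "x + y \<in> direct_sum I G"
      using keys_add[of x y] v.subspace_add[OF subG] by (auto simp: direct_sum_def lookup_add)
  next
    fix c x assume "x \<in> direct_sum I G"
    then show "pm_scale s c x \<in> direct_sum I G"
      using v.subspace_scale[OF subG]
      by (auto simp: direct_sum_def lookup_pm_scale[OF s] in_keys_iff)
  qed
  have col: "colim_vec s I G = q ` direct_sum I G"
    by (simp add: colim_vec_def q_def R_def)
  have subC: "d.subspace (colim_vec s I G)"
    unfolding col using q dir by (rule dd.linear_subspace_image)
  have zero: "F 0 = 0" if "linear_on (pm_scale s) t (colim_vec s I G) F" for F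
    using that d.subspace_0[OF subC] unfolding linear_on_def
    by (metis d.scale_zero_left w.scale_zero_left)
  have single: "q (Poly_Mapping.single k v) \<in> colim_vec s I G" if "k \<in> I" "v \<in> Obj G k" for k v
    using that v.subspace_0[OF subG]
    by (auto simp: col direct_sum_def lookup_single when_def split: if_splits intro!: imageI)
  obtain x where x: "x \<in> direct_sum I G" "c = q x"
    using c by (auto simp: col)
  have "(\<Sum>k\<in>K. q (Poly_Mapping.single k (Poly_Mapping.lookup x k))) \<in> colim_vec s I G \<and>
      H (\<Sum>k\<in>K. q (Poly_Mapping.single k (Poly_Mapping.lookup x k))) =
      H' (\<Sum>k\<in>K. q (Poly_Mapping.single k (Poly_Mapping.lookup x k)))"
    if "finite K" "K \<subseteq> I" for K
    using that
  proof (induction K)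
    case empty
    then show ?case
      using zero[OF H] zero[OF H'] d.subspace_0[OF subC] by simp
  next
    case (insert k K)
    have v: "k \<in> I" "Poly_Mapping.lookup x k \<in> Obj G k"
      using x insert by (auto simp: direct_sum_def)
    show ?case
      using insert H H' single[OF v] eq[OF v] d.subspace_add[OF subC]
      by (simp add: linear_on_def in_q)
  qed
  moreover have "c = (\<Sum>k\<in>Poly_Mapping.keys x. q (Poly_Mapping.single k (Poly_Mapping.lookup x k)))"
    unfolding x(2) by (subst poly_mapping_eq_sum_single[of x]) (rule q.sum)
  ultimately show "H c = H' c"
    using x(1) by (simp add: direct_sum_def)
qed

lemma canonical_map_eq:
  assumes s: "vector_space s" and I: "I \<in> intervals" and x: "x \<in> lim_vec I G" and a: "a \<in> I"
  shows "canonical_map s I G x = colim_vec_in s I G a (x a)"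
proof -
  have adjacent: "colim_vec_in s I G k (x k) = colim_vec_in s I G l (x l)"
    if "k \<in> I" "l \<in> I" "k \<le> l" for k l
    using colim_vec_in_compatible[OF s that, of "x k" G] x that by (auto simp: lim_vec_def)
  define b where "b = (SOME b. b \<in> I)"
  have b: "b \<in> I"
    unfolding b_def using a by (rule someI)
  have "(\<lambda>x y. x \<in> I \<and> y \<in> I \<and> (x \<le> y \<or> y \<le> x))\<^sup>*\<^sup>* a b"
    using I a b by (auto simp: intervals_def order_connected_def)
  then have "colim_vec_in s I G a (x a) = colim_vec_in s I G b (x b)"
  proof (induction rule: rtranclp_induct)
    case base
    show ?case by (rule refl)
  next
    case (step k l)
    then show ?case
      using adjacent[of k l] adjacent[of l k] by metis
  qed
  then show ?thesis
    by (simp add: canonical_map_def b_def Let_def)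
qed

lemma free_map_eq_sum:
  assumes "finite K" "Poly_Mapping.keys p \<subseteq> K"
  shows "free_map f p = (\<Sum>x\<in>K. Poly_Mapping.single (f x) (Poly_Mapping.lookup p x))"
  unfolding free_map_def using assms
  by (intro sum.mono_neutral_left) (auto simp: in_keys_iff)

lemma keys_free_map: "Poly_Mapping.keys (free_map f p) \<subseteq> f ` Poly_Mapping.keys p"
proof
  fix y assume "y \<in> Poly_Mapping.keys (free_map f p)"
  then have "(\<Sum>x\<in>Poly_Mapping.keys p. Poly_Mapping.lookup (Poly_Mapping.single (f x) (Poly_Mapping.lookup p x)) y) \<noteq> 0"
    by (simp add: free_map_def in_keys_iff lookup_sum)
  then obtain x where "x \<in> Poly_Mapping.keys p" "Poly_Mapping.lookup (Poly_Mapping.single (f x) (Poly_Mapping.lookup p x)) y \<noteq> 0"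
    by (meson sum.neutral)
  then show "y \<in> f ` Poly_Mapping.keys p"
    by (auto simp: lookup_single when_def split: if_splits)
qed

lemma free_map_add: "free_map f (p + q) = free_map f p + free_map f q"
  using keys_add[of p q]
  by (simp add: free_map_eq_sum[of "Poly_Mapping.keys p \<union> Poly_Mapping.keys q"] lookup_add single_add sum.distrib)

lemma free_map_scale: "free_map f (free_scale c p) = free_scale c (free_map f p)"
proof (rule poly_mapping_eqI)
  fix y
  have "free_map f (free_scale c p) =
      (\<Sum>x\<in>Poly_Mapping.keys p. Poly_Mapping.single (f x) (Poly_Mapping.lookup (free_scale c p) x))"
    by (rule free_map_eq_sum) (auto simp: in_keys_iff lookup_pm_scale[OF vector_space_field])
  then show "Poly_Mapping.lookup (free_map f (free_scale c p)) y = Poly_Mapping.lookup (free_scale c (free_map f p)) y"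
    by (simp add: free_map_def lookup_pm_scale[OF vector_space_field] lookup_sum lookup_single
        sum_distrib_left when_def if_distrib cong: if_cong)
qed

lemma free_map_single: "free_map f (Poly_Mapping.single x c) = Poly_Mapping.single (f x) c"
  by (subst free_map_eq_sum[of "{x}"]) auto

lemma free_map_sum: "free_map f (sum g K) = (\<Sum>k\<in>K. free_map f (g k))"
  by (induction K rule: infinite_finite_induct) (auto simp: free_map_add, simp_all add: free_map_def)

lemma free_diagram_functor_to_vec:
  assumes M: "functor_to_finite_sets M"
  shows "functor_to_vec free_scale (free_diagram M :: ('p::order, 'a \<Rightarrow>\<^sub>0 'f::field) diagram)"
proof -
  interpret vector_space "free_scale :: 'f \<Rightarrow> ('a \<Rightarrow>\<^sub>0 'f) \<Rightarrow> _"
    by (rule vector_space_pm_scale) (rule vector_space_field)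
  have sub: "subspace (free_space X)" for X
  proof (rule subspaceI)
    fix x y :: "'a \<Rightarrow>\<^sub>0 'f" assume "x \<in> free_space X" "y \<in> free_space X"
    then show "x + y \<in> free_space X"
      using keys_add[of x y] by (auto simp: free_space_def)
  qed (auto simp: free_space_def in_keys_iff lookup_pm_scale[OF vector_space_field])
  have fin: "free_space X = span ((\<lambda>x. Poly_Mapping.single x 1) ` X)" for X
  proof (rule span_subspace[symmetric])
    show "free_space X \<subseteq> span ((\<lambda>x. Poly_Mapping.single x 1) ` X)"
    proof
      fix p :: "'a \<Rightarrow>\<^sub>0 'f" assume p: "p \<in> free_space X"
      have "p = (\<Sum>x\<in>Poly_Mapping.keys p. free_scale (Poly_Mapping.lookup p x) (Poly_Mapping.single x 1))"
        by (rule trans[OF poly_mapping_eq_sum_single], rule sum.cong)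
          (auto intro!: poly_mapping_eqI
            simp: lookup_pm_scale[OF vector_space_field] lookup_single when_def)
      also have "\<dots> \<in> span ((\<lambda>x. Poly_Mapping.single x 1) ` X)"
        using p by (intro span_sum span_scale span_base) (auto simp: free_space_def)
      finally show "p \<in> span ((\<lambda>x. Poly_Mapping.single x 1) ` X)" .
    qed
  qed (auto simp: sub, auto simp: free_space_def)
  have Hom_in: "Hom M k l \<in> Obj M k \<rightarrow> Obj M l" if "k \<le> l" for k l
    using M that by (auto simp: functor_to_finite_sets_def functor_to_sets_def)
  have "free_map (Hom M k l) \<in> free_space (Obj M k) \<rightarrow> (free_space (Obj M l) :: ('a \<Rightarrow>\<^sub>0 'f) set)"
    if "k \<le> l" for k l
    using Hom_in[OF that] keys_free_map[of "Hom M k l"] by (fastforce simp: free_space_def)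
  moreover have "free_map (Hom M k k) p = p" if "p \<in> free_space (Obj M k)" for k and p :: "'a \<Rightarrow>\<^sub>0 'f"
  proof -
    have "free_map (Hom M k k) p = (\<Sum>x\<in>Poly_Mapping.keys p. Poly_Mapping.single x (Poly_Mapping.lookup p x))"
      unfolding free_map_def using that M
      by (intro sum.cong) (auto simp: free_space_def functor_to_finite_sets_def functor_to_sets_def)
    then show ?thesis
      using poly_mapping_eq_sum_single[of p] by simp
  qed
  moreover have "free_map (Hom M l m) (free_map (Hom M k l) p) = free_map (Hom M k m) p"
    if "k \<le> l" "l \<le> m" "p \<in> free_space (Obj M k)" for k l m and p :: "'a \<Rightarrow>\<^sub>0 'f"
  proof -
    have "free_map (Hom M l m) (free_map (Hom M k l) p) =
        (\<Sum>x\<in>Poly_Mapping.keys p. Poly_Mapping.single (Hom M l m (Hom M k l x)) (Poly_Mapping.lookup p x))"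
      by (simp add: free_map_def[of "Hom M k l"] free_map_sum free_map_single)
    also have "\<dots> = free_map (Hom M k m) p"
      unfolding free_map_def using that M
      by (intro sum.cong)
        (auto simp: free_space_def functor_to_finite_sets_def functor_to_sets_def subset_iff)
    finally show ?thesis .
  qed
  ultimately have "functor_to_sets (free_diagram M :: ('p, 'a \<Rightarrow>\<^sub>0 'f) diagram)"
    by (simp add: functor_to_sets_def free_diagram_def)
  moreover have "finite (Obj M k)" for k
    using M by (simp add: functor_to_finite_sets_def)
  ultimately show ?thesis
    using fin by (auto simp: functor_to_vec_def functor_to_Vec_def sub linear_on_def
        free_diagram_def free_map_add free_map_scale intro: finite_imageI)
qed

end

theory Submission
  imports Defs
begin

text \<open>
  The colimit of \<open>L \<circ> M\<close> is the free vector space on the colimit of \<open>M\<close>.  Pushing a section of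
  \<open>L \<circ> M\<close> over \<open>I\<close> forward to the colimit gives the same vector from every index, so this vector is
  supported on full components.  It remains to find, for every full component \<open>c\<close>, a section
  that is mapped to the basis vector \<open>c\<close>.  Such a section is a linear functional on the space
  with basis \<open>c\<close> that kills the relations \<open>\<Sum>x\<in>f\<^sup>-\<^sup>1(y). [x] - [y]\<close> and is \<open>1\<close> on the sum \<open>u\<close> of the
  elements of \<open>c\<close> over one index \<open>a\<close>; it exists if \<open>u\<close> is not in the span of the relations.
  If it were, the coefficients of the relations would yield a locally constant function on \<open>c\<close>
  that is \<open>0\<close> far to the right of \<open>a\<close> (or at the right end of \<open>I\<close>) and \<open>1\<close> far to the left
  (or at the left end), contradicting the connectedness of \<open>c\<close>.  This also covers infinite intervals, since a linear combination is finite.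
\<close>

section \<open>Classes of the colimit of sets\<close>

lemma equivclp_colim_rel_Sigma:
  assumes "equivclp (colim_rel I N) u v" "u \<in> Sigma I (Obj N)"
  shows "v \<in> Sigma I (Obj N)"
  using assms by (induction rule: equivclp_induct) (auto simp: colim_rel_def)

lemma colim_rel_Hom:
  assumes "functor_to_sets N" "k \<in> I" "l \<in> I" "k \<le> l" "x \<in> Obj N k"
  shows "colim_rel I N (k, x) (l, Hom N k l x)"
  using assms by (auto simp: colim_rel_def functor_to_sets_def)

lemma equivclp_iff_of_equivclp:
  assumes "equivclp R u v"
  shows "equivclp R u w \<longleftrightarrow> equivclp R v w"
  using equivclp_trans[OF assms] equivclp_trans[OF equivclp_sym[OF assms]] by (rule iffI[rotated])

lemma colim_set_in_eq_iff:
  "colim_set_in I N k x = colim_set_in I N l y \<longleftrightarrow> equivclp (colim_rel I N) (k, x) (l, y)"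
proof
  assume "colim_set_in I N k x = colim_set_in I N l y"
  moreover have "(l, y) \<in> colim_set_in I N l y"
    by (simp add: colim_set_in_def)
  ultimately have "(l, y) \<in> colim_set_in I N k x"
    by simp
  then show "equivclp (colim_rel I N) (k, x) (l, y)"
    by (simp add: colim_set_in_def)
next
  assume "equivclp (colim_rel I N) (k, x) (l, y)"
  then show "colim_set_in I N k x = colim_set_in I N l y"
    unfolding colim_set_in_def by (intro Collect_cong equivclp_iff_of_equivclp)
qed

lemma colim_setE:
  assumes "c \<in> colim_set I N"
  obtains k x where "k \<in> I" "x \<in> Obj N k" "c = colim_set_in I N k x"
  using assms by (auto simp: colim_set_def colim_set_in_def quotient_def)

lemma colim_set_in_mem:
  assumes "k \<in> I" "x \<in> Obj N k"
  shows "colim_set_in I N k x \<in> colim_set I N"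
  using assms by (auto simp: colim_set_def colim_set_in_def quotient_def)

lemma colim_set_in_eq_class_iff:
  assumes "c \<in> colim_set I N"
  shows "colim_set_in I N k x = c \<longleftrightarrow> (k, x) \<in> c"
proof -
  obtain l y where c: "c = colim_set_in I N l y"
    using assms by (rule colim_setE)
  have "colim_set_in I N l y = colim_set_in I N k x \<longleftrightarrow> (k, x) \<in> c"
    unfolding c colim_set_in_eq_iff by (simp add: colim_set_in_def)
  then show ?thesis
    unfolding c by (simp only: eq_commute)
qed

lemma colim_set_subset_Sigma:
  assumes "c \<in> colim_set I N"
  shows "c \<subseteq> Sigma I (Obj N)"
proof
  fix v assume "v \<in> c"
  obtain k x where kx: "k \<in> I" "x \<in> Obj N k" and c: "c = colim_set_in I N k x"
    using assms by (rule colim_setE)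
  have "equivclp (colim_rel I N) (k, x) v"
    using \<open>v \<in> c\<close> unfolding c colim_set_in_def by simp
  then show "v \<in> Sigma I (Obj N)"
    by (rule equivclp_colim_rel_Sigma) (simp add: kx)
qed

lemma colim_set_equivclp_iff:
  assumes "c \<in> colim_set I N" "u \<in> c"
  shows "equivclp (colim_rel I N) u v \<longleftrightarrow> v \<in> c"
proof -
  obtain k x where c: "c = colim_set_in I N k x"
    using assms(1) by (rule colim_setE)
  have "equivclp (colim_rel I N) (k, x) u"
    using \<open>u \<in> c\<close> unfolding c colim_set_in_def by simp
  from equivclp_iff_of_equivclp[OF this, of v] show ?thesis
    unfolding c colim_set_in_def by simp
qed

lemma colim_rel_same_class:
  assumes c: "c \<in> colim_set I N" and uv: "colim_rel I N u v"
  shows "u \<in> c \<longleftrightarrow> v \<in> c"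
proof
  have equiv: "equivclp (colim_rel I N) u v"
    using uv by (rule r_into_equivclp)
  show "v \<in> c" if "u \<in> c"
    using colim_set_equivclp_iff[OF c that] equiv by blast
  show "u \<in> c" if "v \<in> c"
    using colim_set_equivclp_iff[OF c that] equivclp_sym[OF equiv] by blast
qed

lemma locally_constant_on_class:
  assumes c: "c \<in> colim_set I N" and "u \<in> c" "v \<in> c"
    and h: "\<And>u v. colim_rel I N u v \<Longrightarrow> u \<in> c \<Longrightarrow> v \<in> c \<Longrightarrow> h u = h v"
  shows "h u = h v"
proof -
  have "equivclp (colim_rel I N) u v"
    using colim_set_equivclp_iff[OF c \<open>u \<in> c\<close>] \<open>v \<in> c\<close> by blast
  \<comment> \<open>Membership in \<open>c\<close> is carried through the induction, because
    \<open>h\<close> is known to be invariant only between elements of \<open>c\<close>.\<close>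
  then have "v \<in> c \<and> h u = h v"
  proof (induction rule: equivclp_induct)
    case base
    show ?case using \<open>u \<in> c\<close> by simp
  next
    case (step y z)
    then show ?case
      using h[of y z] h[of z y] colim_rel_same_class[OF c, of y z] colim_rel_same_class[OF c, of z y]
      by auto
  qed
  then show ?thesis ..
qed

lemma full_componentsD:
  assumes "c \<in> full_components I N"
  shows "c \<in> colim_set I N" "\<And>k. k \<in> I \<Longrightarrow> \<exists>x\<in>Obj N k. (k, x) \<in> c"
proof -
  show c: "c \<in> colim_set I N"
    using assms by (simp add: full_components_def)
  fix k assume k: "k \<in> I"
  then have "k \<in> supp I N c"
    using assms by (simp add: full_components_def)
  then obtain x where "x \<in> Obj N k" "colim_set_in I N k x = c"
    by (auto simp: supp_def)
  then show "\<exists>x\<in>Obj N k. (k, x) \<in> c"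
    using colim_set_in_eq_class_iff[OF c] by blast
qed


section \<open>Positions in the zigzag\<close>

text \<open>The zigzag laid out on a line: \<open>(i, i)\<close> goes to \<open>2 * i\<close> and
  \<open>(i, i - 1)\<close> to \<open>2 * i - 1\<close>, so the elements are numbered by the
  integers and distinct comparable elements are neighbours.\<close>

definition zz_pos :: "zz \<Rightarrow> int" where
  "zz_pos p = fst (Rep_zz p) + snd (Rep_zz p)"

lemma Rep_zz_cases: "snd (Rep_zz p) = fst (Rep_zz p) \<or> snd (Rep_zz p) = fst (Rep_zz p) - 1"
  using Rep_zz[of p] by auto

lemma zz_pos_eq_iff [simp]: "zz_pos p = zz_pos q \<longleftrightarrow> p = q"
proof
  assume "zz_pos p = zz_pos q"
  then have "Rep_zz p = Rep_zz q"
    using Rep_zz_cases[of p] Rep_zz_cases[of q] by (simp add: zz_pos_def prod_eq_iff) presburger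
  then show "p = q"
    by (simp add: Rep_zz_inject)
qed simp

lemma zz_le_cases:
  assumes "p \<le> q"
  obtains "p = q" | "zz_pos q = zz_pos p + 1" | "zz_pos q = zz_pos p - 1"
proof -
  have "zz_pos q = zz_pos p \<or> zz_pos q = zz_pos p + 1 \<or> zz_pos q = zz_pos p - 1"
    using assms Rep_zz_cases[of p] Rep_zz_cases[of q] by (auto simp: less_eq_zz_def zz_pos_def)
  then show thesis
    using that by auto
qed


section \<open>Relations between the elements of a component\<close>

lemma vector_space_free: "vector_space (free_scale :: 'f::field \<Rightarrow> ('a \<Rightarrow>\<^sub>0 'f) \<Rightarrow> _)"
  by (rule vector_space_pm_scale) (rule vector_space_field)

text \<open>Compatibility along \<open>k \<le> l\<close> in dual form: a functional whose values on
  the basis are the coefficients of a vector over \<open>k\<close> and one over \<open>l\<close>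
  kills this element iff the pushforward of the first has the coefficient of the second at
  \<open>y\<close>.\<close>

definition fiber_relation ::
    "('p, 'a) diagram \<Rightarrow> ('p \<times> 'a) set \<Rightarrow> 'p \<Rightarrow> 'p \<Rightarrow> 'a \<Rightarrow> ('p \<times> 'a \<Rightarrow>\<^sub>0 'f::field)" where
  "fiber_relation M c k l y =
     (\<Sum>x | x \<in> Obj M k \<and> (k, x) \<in> c \<and> Hom M k l x = y. Poly_Mapping.single (k, x) 1) -
     Poly_Mapping.single (l, y) 1"

definition fiber_relations ::
    "'p::order set \<Rightarrow> ('p, 'a) diagram \<Rightarrow> ('p \<times> 'a) set \<Rightarrow> ('p \<times> 'a \<Rightarrow>\<^sub>0 'f::field) set" where
  "fiber_relations I M c =
     {fiber_relation M c k l y | k l y. k \<in> I \<and> l \<in> I \<and> k \<le> l \<and> (l, y) \<in> c}"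

lemma lookup_fiber_relation:
  assumes "finite (Obj M k)" "c \<subseteq> Sigma I (Obj M)" "e \<in> c"
  shows "Poly_Mapping.lookup (fiber_relation M c k l y) e =
    of_bool (fst e = k \<and> Hom M k l (snd e) = y) - of_bool (e = (l, y))"
proof -
  obtain m z where e: "e = (m, z)" by fastforce
  have "(\<Sum>x | x \<in> Obj M k \<and> (k, x) \<in> c \<and> Hom M k l x = y.
      Poly_Mapping.lookup (Poly_Mapping.single (k, x) 1) e) =
    (\<Sum>x | x \<in> Obj M k \<and> (k, x) \<in> c \<and> Hom M k l x = y. if x = z then of_bool (m = k) else 0 :: 'd::field)"
    by (rule sum.cong) (auto simp: lookup_single when_def e)
  also have "\<dots> = of_bool (m = k \<and> Hom M k l z = y)"
    using assms by (subst sum.delta) (auto simp: e)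
  finally show ?thesis
    by (auto simp: fiber_relation_def lookup_minus lookup_sum e lookup_single when_def)
qed

text \<open>
  Combinations of relations, given by the coefficients \<open>r e\<close> and \<open>l e\<close> (up to sign) with which the
  element \<open>e\<close> takes part in relations with the position to its right and to its left.
\<close>

definition balanced ::
    "zz set \<Rightarrow> (zz, 'a) diagram \<Rightarrow> (zz \<times> 'a) set \<Rightarrow> (zz \<times> 'a \<Rightarrow>\<^sub>0 'f::field) \<Rightarrow> bool" where
  "balanced I M c v \<longleftrightarrow> (\<exists>r l N.
     (\<forall>e\<in>c. Poly_Mapping.lookup v e = r e - l e) \<and>
     (\<forall>e\<in>c. \<forall>e'\<in>c. zz_pos (fst e') = zz_pos (fst e) + 1 \<longrightarrow>
        colim_rel I M e e' \<or> colim_rel I M e' e \<longrightarrow> r e = l e') \<and>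
     (\<forall>e\<in>c. zz_pos (fst e) + 1 \<notin> zz_pos ` I \<or> N < \<bar>zz_pos (fst e)\<bar> \<longrightarrow> r e = 0) \<and>
     (\<forall>e\<in>c. zz_pos (fst e) - 1 \<notin> zz_pos ` I \<or> N < \<bar>zz_pos (fst e)\<bar> \<longrightarrow> l e = 0))"

lemma balancedI:
  assumes "\<And>e. e \<in> c \<Longrightarrow> Poly_Mapping.lookup v e = r e - l e"
    and "\<And>e e'. e \<in> c \<Longrightarrow> e' \<in> c \<Longrightarrow> zz_pos (fst e') = zz_pos (fst e) + 1 \<Longrightarrow>
      colim_rel I M e e' \<or> colim_rel I M e' e \<Longrightarrow> r e = l e'"
    and "\<And>e. e \<in> c \<Longrightarrow> zz_pos (fst e) + 1 \<notin> zz_pos ` I \<or> N < \<bar>zz_pos (fst e)\<bar> \<Longrightarrow> r e = 0"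
    and "\<And>e. e \<in> c \<Longrightarrow> zz_pos (fst e) - 1 \<notin> zz_pos ` I \<or> N < \<bar>zz_pos (fst e)\<bar> \<Longrightarrow> l e = 0"
  shows "balanced I M c v"
  unfolding balanced_def using assms by blast

lemma balancedE:
  assumes "balanced I M c v"
  obtains r l N where
    "\<And>e. e \<in> c \<Longrightarrow> Poly_Mapping.lookup v e = r e - l e"
    "\<And>e e'. e \<in> c \<Longrightarrow> e' \<in> c \<Longrightarrow> zz_pos (fst e') = zz_pos (fst e) + 1 \<Longrightarrow>
      colim_rel I M e e' \<or> colim_rel I M e' e \<Longrightarrow> r e = l e'"
    "\<And>e. e \<in> c \<Longrightarrow> zz_pos (fst e) + 1 \<notin> zz_pos ` I \<or> N < \<bar>zz_pos (fst e)\<bar> \<Longrightarrow> r e = 0"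
    "\<And>e. e \<in> c \<Longrightarrow> zz_pos (fst e) - 1 \<notin> zz_pos ` I \<or> N < \<bar>zz_pos (fst e)\<bar> \<Longrightarrow> l e = 0"
proof -
  obtain r l N where *: "(\<forall>e\<in>c. Poly_Mapping.lookup v e = r e - l e) \<and>
     (\<forall>e\<in>c. \<forall>e'\<in>c. zz_pos (fst e') = zz_pos (fst e) + 1 \<longrightarrow>
        colim_rel I M e e' \<or> colim_rel I M e' e \<longrightarrow> r e = l e') \<and>
     (\<forall>e\<in>c. zz_pos (fst e) + 1 \<notin> zz_pos ` I \<or> N < \<bar>zz_pos (fst e)\<bar> \<longrightarrow> r e = 0) \<and>
     (\<forall>e\<in>c. zz_pos (fst e) - 1 \<notin> zz_pos ` I \<or> N < \<bar>zz_pos (fst e)\<bar> \<longrightarrow> l e = 0)"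
    using assms unfolding balanced_def by (elim exE) (rule that)
  show thesis
    by (rule that[of r l N]) (use * in blast)+
qed

section \<open>Balance of linear combinations of relations\<close>

lemma balanced_zero: "balanced I M c 0"
  by (rule balancedI[where r = "\<lambda>_. 0" and l = "\<lambda>_. 0"]) auto

lemma balanced_add:
  assumes "balanced I M c v" "balanced I M c w"
  shows "balanced I M c (v + w)"
proof -
  obtain r l N where v:
      "\<And>e. e \<in> c \<Longrightarrow> Poly_Mapping.lookup v e = r e - l e"
      "\<And>e e'. e \<in> c \<Longrightarrow> e' \<in> c \<Longrightarrow> zz_pos (fst e') = zz_pos (fst e) + 1 \<Longrightarrow>
        colim_rel I M e e' \<or> colim_rel I M e' e \<Longrightarrow> r e = l e'"
      "\<And>e. e \<in> c \<Longrightarrow> zz_pos (fst e) + 1 \<notin> zz_pos ` I \<or> N < \<bar>zz_pos (fst e)\<bar> \<Longrightarrow> r e = 0"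
      "\<And>e. e \<in> c \<Longrightarrow> zz_pos (fst e) - 1 \<notin> zz_pos ` I \<or> N < \<bar>zz_pos (fst e)\<bar> \<Longrightarrow> l e = 0"
    using assms(1) by (elim balancedE) blast
  obtain r' l' N' where w:
      "\<And>e. e \<in> c \<Longrightarrow> Poly_Mapping.lookup w e = r' e - l' e"
      "\<And>e e'. e \<in> c \<Longrightarrow> e' \<in> c \<Longrightarrow> zz_pos (fst e') = zz_pos (fst e) + 1 \<Longrightarrow>
        colim_rel I M e e' \<or> colim_rel I M e' e \<Longrightarrow> r' e = l' e'"
      "\<And>e. e \<in> c \<Longrightarrow> zz_pos (fst e) + 1 \<notin> zz_pos ` I \<or> N' < \<bar>zz_pos (fst e)\<bar> \<Longrightarrow> r' e = 0"
      "\<And>e. e \<in> c \<Longrightarrow> zz_pos (fst e) - 1 \<notin> zz_pos ` I \<or> N' < \<bar>zz_pos (fst e)\<bar> \<Longrightarrow> l' e = 0"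
    using assms(2) by (elim balancedE) blast
  show ?thesis
    by (rule balancedI[where r = "\<lambda>e. r e + r' e" and l = "\<lambda>e. l e + l' e" and N = "max N N'"])
      (use v w in \<open>auto simp: lookup_add\<close>)
qed

lemma balanced_scale:
  assumes "balanced I M c v"
  shows "balanced I M c (free_scale t v)"
  using assms
proof (elim balancedE)
  fix r l N
  assume v: "\<And>e. e \<in> c \<Longrightarrow> Poly_Mapping.lookup v e = r e - l e"
      "\<And>e e'. e \<in> c \<Longrightarrow> e' \<in> c \<Longrightarrow> zz_pos (fst e') = zz_pos (fst e) + 1 \<Longrightarrow>
        colim_rel I M e e' \<or> colim_rel I M e' e \<Longrightarrow> r e = l e'"
      "\<And>e. e \<in> c \<Longrightarrow> zz_pos (fst e) + 1 \<notin> zz_pos ` I \<or> N < \<bar>zz_pos (fst e)\<bar> \<Longrightarrow> r e = 0"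
      "\<And>e. e \<in> c \<Longrightarrow> zz_pos (fst e) - 1 \<notin> zz_pos ` I \<or> N < \<bar>zz_pos (fst e)\<bar> \<Longrightarrow> l e = 0"
  show ?thesis
    by (rule balancedI[where r = "\<lambda>e. t * r e" and l = "\<lambda>e. t * l e" and N = N])
      (use v in \<open>auto simp: lookup_pm_scale[OF vector_space_field] right_diff_distrib\<close>)
qed

text \<open>For \<open>k \<noteq> l\<close> the relation lives on two neighbouring levels, and its
  fibre and \<open>y\<close> enter with the same coefficient across the edges joining them. The
  bound \<open>N\<close> only has to cover these two levels.\<close>

lemma balanced_fiber_relation:
  fixes M :: "(zz, 'a) diagram"
  assumes M: "functor_to_finite_sets M" and c: "c \<subseteq> Sigma I (Obj M)"
    and k: "k \<in> I" and l: "l \<in> I" and kl: "k \<le> l" and y: "(l, y) \<in> c"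
  shows "balanced I M c (fiber_relation M c k l y :: _ \<Rightarrow>\<^sub>0 'f::field)"
proof -
  have fin: "finite (Obj M k)" using M by (simp add: functor_to_finite_sets_def)
  show ?thesis
    using kl
  proof (cases rule: zz_le_cases)
    case 1
    \<comment> \<open>The fibre of the identity over \<open>y\<close> is \<open>y\<close> alone, so
      the relation vanishes on \<open>c\<close>.\<close>
    have "Hom M k k z = z" if "(k, z) \<in> c" for z
      using M c that by (auto simp: functor_to_finite_sets_def functor_to_sets_def)
    then have "Poly_Mapping.lookup (fiber_relation M c k l y :: _ \<Rightarrow>\<^sub>0 'f) e = 0" if "e \<in> c" for e
      using that 1 fin by (cases e) (auto simp: lookup_fiber_relation[OF _ c])
    then show ?thesis
      by (intro balancedI[where r = "\<lambda>_. 0" and l = "\<lambda>_. 0"]) auto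
  next
    case 2
    have 3: "zz_pos k + 1 \<in> zz_pos ` I" "zz_pos l - 1 \<in> zz_pos ` I"
      using 2 k l by (auto intro: image_eqI[of _ _ l] image_eqI[of _ _ k])
    \<comment> \<open>Here \<open>l\<close> is to the right of \<open>k\<close>: the fibre takes
      part on its right, \<open>y\<close> on its left.\<close>
    show ?thesis
    proof (rule balancedI[where r = "\<lambda>e. of_bool (fst e = k \<and> Hom M k l (snd e) = y)"
          and l = "\<lambda>e. of_bool (e = (l, y))" and N = "max \<bar>zz_pos k\<bar> \<bar>zz_pos l\<bar>"])
      fix e e' assume e: "e \<in> c" "e' \<in> c" "zz_pos (fst e') = zz_pos (fst e) + 1"
        "colim_rel I M e e' \<or> colim_rel I M e' e"
      have "fst e = k \<longleftrightarrow> fst e' = l"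
        using e(3) 2 zz_pos_eq_iff[of "fst e" k] zz_pos_eq_iff[of "fst e'" l] by linarith
      moreover have "\<not> l \<le> k" using kl 2 by auto
      ultimately show "of_bool (fst e = k \<and> Hom M k l (snd e) = y) = (of_bool (e' = (l, y)) :: 'f)"
        using e(4) by (auto simp: colim_rel_def prod_eq_iff)
    qed (use 3 in \<open>auto simp: lookup_fiber_relation[OF fin c]\<close>)
  next
    case 3
    have 4: "zz_pos l + 1 \<in> zz_pos ` I" "zz_pos k - 1 \<in> zz_pos ` I"
      using 3 k l by (auto intro: image_eqI[of _ _ l] image_eqI[of _ _ k])
    \<comment> \<open>Mirror image: \<open>l\<close> is to the left of \<open>k\<close>, so right
      and left change roles, and both coefficients change sign because the entries are right minus
      left.\<close>
    show ?thesis
    proof (rule balancedI[where l = "\<lambda>e. - of_bool (fst e = k \<and> Hom M k l (snd e) = y)"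
          and r = "\<lambda>e. - of_bool (e = (l, y))" and N = "max \<bar>zz_pos k\<bar> \<bar>zz_pos l\<bar>"])
      fix e e' assume e: "e \<in> c" "e' \<in> c" "zz_pos (fst e') = zz_pos (fst e) + 1"
        "colim_rel I M e e' \<or> colim_rel I M e' e"
      have "fst e' = k \<longleftrightarrow> fst e = l"
        using e(3) 3 zz_pos_eq_iff[of "fst e'" k] zz_pos_eq_iff[of "fst e" l] by linarith
      moreover have "\<not> l \<le> k" using kl 3 by auto
      ultimately show "- of_bool (e = (l, y)) = (- of_bool (fst e' = k \<and> Hom M k l (snd e') = y) :: 'f)"
        using e(4) by (auto simp: colim_rel_def prod_eq_iff)
    qed (use 4 in \<open>auto simp: lookup_fiber_relation[OF fin c]\<close>)
  qed
qed

text \<open>Only finitely many relations enter a combination, so their bounds \<open>N\<close> have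
  a common maximum.\<close>

lemma span_fiber_relations_balanced:
  fixes M :: "(zz, 'a) diagram" and v :: "zz \<times> 'a \<Rightarrow>\<^sub>0 'f::field"
  assumes "functor_to_finite_sets M" "c \<subseteq> Sigma I (Obj M)"
    and "v \<in> module.span free_scale (fiber_relations I M c)"
  shows "balanced I M c v"
proof -
  interpret vector_space "free_scale :: 'f \<Rightarrow> (zz \<times> 'a \<Rightarrow>\<^sub>0 'f) \<Rightarrow> _"
    by (rule vector_space_free)
  show ?thesis
    using assms(3)
  proof (induction rule: span_induct_alt)
    case base
    show ?case by (rule balanced_zero)
  next
    case (step t x y)
    then obtain k l z where "x = fiber_relation M c k l z" "k \<in> I" "l \<in> I" "k \<le> l" "(l, z) \<in> c"
      by (auto simp: fiber_relations_def)
    then have "balanced I M c x"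
      using balanced_fiber_relation[OF assms(1,2)] by blast
    then show ?case
      using step by (intro balanced_add balanced_scale)
  qed
qed

section \<open>The ends of the interval and the level sum\<close>

text \<open>Unit steps from \<open>a\<close> can be continued until a right neighbour is missing or
  the bound is passed. This finds a position where \<open>balanced\<close> forces a coefficient to
  vanish.\<close>

lemma int_set_upper_cases:
  fixes S :: "int set"
  assumes "a \<in> S"
  shows "\<exists>b\<in>S. a \<le> b \<and> (b + 1 \<notin> S \<or> N < \<bar>b\<bar>)"
proof (rule ccontr)
  assume *: "\<not> ?thesis"
  have "a + int n \<in> S" for n
  proof (induction n)
    case (Suc n)
    then have "a + int n + 1 \<in> S" using * by force
    then show ?case by (simp add: algebra_simps)
  qed (simp add: assms)
  \<comment> \<open>So many steps lead beyond \<open>N\<close>; the summand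
    \<open>\<bar>a\<bar>\<close> makes up for a negative start.\<close>
  from this[of "nat (\<bar>N\<bar> + \<bar>a\<bar> + 1)"] show False
    using * by force
qed

lemma int_set_lower_cases:
  fixes S :: "int set"
  assumes "a \<in> S"
  shows "\<exists>b\<in>S. b \<le> a \<and> (b - 1 \<notin> S \<or> N < \<bar>b\<bar>)"
proof -
  have "- a \<in> uminus ` S" using assms by simp
  from int_set_upper_cases[OF this, of N] obtain b where
    "b \<in> S" "- a \<le> - b" "- b + 1 \<notin> uminus ` S \<or> N < \<bar>- b\<bar>" by auto
  moreover have "b - 1 \<in> S \<Longrightarrow> - b + 1 \<in> uminus ` S" by (auto intro: image_eqI[of _ _ "b - 1"])
  ultimately show ?thesis by force
qed

lemma level_sum_not_balanced:
  fixes M :: "(zz, 'a) diagram" and u :: "zz \<times> 'a \<Rightarrow>\<^sub>0 'f::field"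
  assumes M: "functor_to_sets M" and c: "c \<in> full_components I M" and a: "a \<in> I"
    and u: "\<And>e. e \<in> c \<Longrightarrow> Poly_Mapping.lookup u e = of_bool (fst e = a)"
  shows "\<not> balanced I M c u"
proof
  assume "balanced I M c u"
  then obtain r l N where u_rl: "\<And>e. e \<in> c \<Longrightarrow> Poly_Mapping.lookup u e = r e - l e"
      and edge: "\<And>e e'. e \<in> c \<Longrightarrow> e' \<in> c \<Longrightarrow> zz_pos (fst e') = zz_pos (fst e) + 1 \<Longrightarrow>
        colim_rel I M e e' \<or> colim_rel I M e' e \<Longrightarrow> r e = l e'"
      and r0: "\<And>e. e \<in> c \<Longrightarrow> zz_pos (fst e) + 1 \<notin> zz_pos ` I \<or> N < \<bar>zz_pos (fst e)\<bar> \<Longrightarrow> r e = 0"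
      and l0: "\<And>e. e \<in> c \<Longrightarrow> zz_pos (fst e) - 1 \<notin> zz_pos ` I \<or> N < \<bar>zz_pos (fst e)\<bar> \<Longrightarrow> l e = 0"
    by (elim balancedE) blast
  have rl: "r e = l e + of_bool (fst e = a)" if "e \<in> c" for e
    using u[OF that] u_rl[OF that] by (simp add: algebra_simps)
  \<comment> \<open>\<open>h\<close> reads the coefficient on the right of \<open>e\<close>. On
    passing an element over \<open>a\<close> this coefficient jumps by 1, and the shift left of
    \<open>a\<close> compensates the jump.\<close>
  define h where "h e = (if zz_pos a \<le> zz_pos (fst e) then r e else r e + 1)" for e
  have h_edge: "h e = h e'"
    if "e \<in> c" "e' \<in> c" "zz_pos (fst e') = zz_pos (fst e) + 1"
      "colim_rel I M e e' \<or> colim_rel I M e' e" for e e'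
    using edge[OF that] rl[OF that(2)] that(3) by (auto simp: h_def simp flip: zz_pos_eq_iff)
  have h_rel: "h e = h e'" if "colim_rel I M e e'" "e \<in> c" "e' \<in> c" for e e'
  proof -
    have le: "fst e \<le> fst e'"
      using that by (simp add: colim_rel_def)
    show ?thesis
      using le
    proof (cases rule: zz_le_cases)
      case 1
      then have "e' = e"
        using that M by (auto simp: colim_rel_def functor_to_sets_def prod_eq_iff)
      then show ?thesis by simp
    qed (use h_edge[of e e'] h_edge[of e' e] that in auto)
  qed
  note cD = full_componentsD[OF c]
  obtain b where b: "b \<in> I" "zz_pos a \<le> zz_pos b" "zz_pos b + 1 \<notin> zz_pos ` I \<or> N < \<bar>zz_pos b\<bar>"
    using int_set_upper_cases[of "zz_pos a" "zz_pos ` I" N] a by auto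
  obtain b' where b': "b' \<in> I" "zz_pos b' \<le> zz_pos a" "zz_pos b' - 1 \<notin> zz_pos ` I \<or> N < \<bar>zz_pos b'\<bar>"
    using int_set_lower_cases[of "zz_pos a" "zz_pos ` I" N] a by auto
  \<comment> \<open>Fullness enters here: \<open>c\<close> has elements over both chosen
    indices.\<close>
  obtain x x' where x: "(b, x) \<in> c" "(b', x') \<in> c"
    using cD(2) b(1) b'(1) by meson
  have "h (b, x) = 0"
    using b r0[OF x(1)] by (simp add: h_def)
  \<comment> \<open>Since \<open>l\<close> vanishes here, \<open>r\<close> is 1 if
    \<open>b' = a\<close>; otherwise \<open>r\<close> is 0 and the shift supplies the 1.\<close>
  moreover have "h (b', x') = 1"
    using b' l0[OF x(2)] rl[OF x(2)] by (auto simp: h_def)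
  moreover have "h (b, x) = h (b', x')"
    using locally_constant_on_class[OF cD(1) x, of h] h_rel by blast
  ultimately show False
    by simp
qed


section \<open>Sections through full components\<close>

text \<open>Modulo the span of \<open>R\<close> the vector \<open>u\<close> stays nonzero, so a
  functional on the quotient can be normalised at its image and pulled back.\<close>

lemma exists_functional:
  fixes s :: "'f::field \<Rightarrow> 'v::ab_group_add \<Rightarrow> 'v"
  assumes s: "vector_space s" and u: "u \<notin> module.span s R"
  shows "\<exists>w. Vector_Spaces.linear s (*) w \<and> (\<forall>r\<in>R. w r = 0) \<and> w u = 1"
proof -
  interpret vector_space s by fact
  interpret f: vector_space "(*) :: 'f \<Rightarrow> 'f \<Rightarrow> 'f" by (rule vector_space_field)
  interpret vector_space_pair s "(*) :: 'f \<Rightarrow> 'f \<Rightarrow> 'f" ..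
  define q where "q = quotient_map s (span R)"
  have q: "Vector_Spaces.linear s s q" "\<And>x. q x = 0 \<longleftrightarrow> x \<in> span R"
    unfolding q_def using quotient_map[OF s subspace_span] by auto
  have "independent {q u}"
    using u q(2) by simp
  then obtain g where g: "Vector_Spaces.linear s (*) g" "g (q u) = 1"
    using linear_independent_extend[of "{q u}" "\<lambda>_. 1"] by auto
  have "Vector_Spaces.linear s (*) (g \<circ> q)"
    using q(1) g(1) by (rule Vector_Spaces.linear_compose)
  moreover have "(g \<circ> q) r = 0" if "r \<in> R" for r
    using q(2)[of r] span_base[OF that] linear_0[OF g(1)] by simp
  ultimately show ?thesis
    using g(2) by (intro exI[of _ "g \<circ> q"]) auto
qed

lemma full_component_lifts:
  fixes M :: "(zz, 'a) diagram"
  assumes M: "functor_to_finite_sets M" and c: "c \<in> full_components I M" and a: "a \<in> I"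
  shows "\<exists>x\<in>lim_vec I (free_diagram M :: (zz, 'a \<Rightarrow>\<^sub>0 'f::field) diagram).
    free_map (colim_set_in I M a) (x a) = Poly_Mapping.single c 1"
proof -
  have Ms: "functor_to_sets M" and fin: "finite (Obj M k)" for k
    using M by (auto simp: functor_to_finite_sets_def)
  note cD = full_componentsD[OF c]
  note cS = colim_set_subset_Sigma[OF cD(1)]
  define Z where "Z k = {z \<in> Obj M k. (k, z) \<in> c}" for k
  have finZ: "finite (Z k)" for k
    using fin by (simp add: Z_def)
  define u :: "zz \<times> 'a \<Rightarrow>\<^sub>0 'f" where "u = (\<Sum>z\<in>Z a. Poly_Mapping.single (a, z) 1)"
  have "Poly_Mapping.lookup u e = of_bool (fst e = a)" if "e \<in> c" for e
  proof -
    have "Poly_Mapping.lookup u e = (\<Sum>z\<in>Z a. if z = snd e then of_bool (fst e = a) else 0)"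
      unfolding u_def lookup_sum
      by (intro sum.cong refl) (cases e; auto simp: lookup_single when_def)
    also have "\<dots> = of_bool (fst e = a)"
      using that cS finZ by (cases e) (auto simp: Z_def)
    finally show ?thesis .
  qed
  then have "\<not> balanced I M c u"
    using level_sum_not_balanced[OF Ms c a] by blast
  then have "u \<notin> module.span free_scale (fiber_relations I M c)"
    using span_fiber_relations_balanced[OF M cS] by blast
  then obtain w :: "(zz \<times> 'a \<Rightarrow>\<^sub>0 'f) \<Rightarrow> 'f" where w: "Vector_Spaces.linear free_scale (*) w"
      and w_rel: "\<And>r. r \<in> fiber_relations I M c \<Longrightarrow> w r = 0" and wu: "w u = 1"
    using exists_functional[OF vector_space_free] by blast
  interpret w: Vector_Spaces.linear free_scale "(*)" w by fact
  \<comment> \<open>The values of \<open>w\<close> on the basis become the coefficients of the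
    section; the value 0 outside \<open>I\<close> is the convention of
    \<open>lim_vec\<close>.\<close>
  define x where "x k = (if k \<in> I then \<Sum>z\<in>Z k. Poly_Mapping.single z (w (Poly_Mapping.single (k, z) 1)) else 0)" for k
  have lookup_x: "Poly_Mapping.lookup (x k) z = (if z \<in> Z k then w (Poly_Mapping.single (k, z) 1) else 0)"
    if "k \<in> I" for k z
    using that finZ by (simp add: x_def lookup_sum lookup_single when_def)
  have keys_x: "Poly_Mapping.keys (x k) \<subseteq> Z k" if "k \<in> I" for k
    using lookup_x[OF that] by (auto simp: in_keys_iff split: if_splits)
  have free_map_x: "free_map f (x k) = (\<Sum>z\<in>Z k. Poly_Mapping.single (f z) (w (Poly_Mapping.single (k, z) 1)))"
    if "k \<in> I" for k and f :: "'a \<Rightarrow> 'c"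
    using free_map_eq_sum[OF finZ keys_x[OF that]] lookup_x[OF that] by simp
  have Hom_x: "free_map (Hom M k l) (x k) = x l" if "k \<in> I" "l \<in> I" "k \<le> l" for k l
  proof (rule poly_mapping_eqI)
    fix y
    let ?F = "{z. z \<in> Obj M k \<and> (k, z) \<in> c \<and> Hom M k l z = y}"
    have "Poly_Mapping.lookup (free_map (Hom M k l) (x k)) y =
        (\<Sum>z\<in>Z k. if Hom M k l z = y then w (Poly_Mapping.single (k, z) 1) else 0)"
      by (simp add: free_map_x[OF that(1)] lookup_sum lookup_single when_def)
    also have "\<dots> = (\<Sum>z\<in>?F. w (Poly_Mapping.single (k, z) 1))"
      using finZ[of k] by (simp add: Z_def sum.inter_filter[symmetric] conj_assoc)
    also have "\<dots> = Poly_Mapping.lookup (x l) y"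
    proof (cases "(l, y) \<in> c")
      case True
      \<comment> \<open>By linearity, this says that the sum over the fibre equals the coefficient
        at \<open>y\<close>.\<close>
      have "w (fiber_relation M c k l y) = 0"
        by (rule w_rel) (use that True in \<open>auto simp: fiber_relations_def\<close>)
      then show ?thesis
        using True cS by (auto simp: fiber_relation_def w.diff w.sum lookup_x[OF that(2)] Z_def)
    next
      case False
      \<comment> \<open>Maps of the diagram preserve classes, so no element of \<open>c\<close> lies
        over a \<open>y\<close> outside \<open>c\<close>, and both sides are 0.\<close>
      have "(l, Hom M k l z) \<in> c" if "z \<in> Obj M k" "(k, z) \<in> c" for z
        using colim_rel_same_class[OF cD(1) colim_rel_Hom[OF Ms \<open>k \<in> I\<close> \<open>l \<in> I\<close> \<open>k \<le> l\<close> that(1)]] that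
        by simp
      then have F: "?F = {}"
        using False by blast
      show ?thesis
        unfolding F using False by (simp add: lookup_x[OF that(2)] Z_def)
    qed
    finally show "Poly_Mapping.lookup (free_map (Hom M k l) (x k)) y = Poly_Mapping.lookup (x l) y" .
  qed
  have "x \<in> lim_vec I (free_diagram M)"
    using keys_x Hom_x by (auto simp: lim_vec_def free_diagram_def free_space_def Z_def x_def[of k for k])
  moreover have "free_map (colim_set_in I M a) (x a) = Poly_Mapping.single c 1"
  proof -
    have "colim_set_in I M a z = c" if "z \<in> Z a" for z
      unfolding colim_set_in_eq_class_iff[OF cD(1)] using that by (simp add: Z_def)
    then have "free_map (colim_set_in I M a) (x a) =
        (\<Sum>z\<in>Z a. Poly_Mapping.single c (w (Poly_Mapping.single (a, z) 1)))"
      unfolding free_map_x[OF a] by (intro sum.cong refl) simp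
    \<comment> \<open>\<open>u\<close> is the sum of the basis vectors of \<open>Z a\<close>, so the
      coefficients collected at \<open>c\<close> add up to \<open>w u\<close>.\<close>
    also have "\<dots> = Poly_Mapping.single c (w u)"
      by (rule poly_mapping_eqI) (simp add: u_def w.sum lookup_sum lookup_single when_def)
    finally show ?thesis
      by (simp add: wu)
  qed
  ultimately show ?thesis
    by blast
qed


section \<open>The colimit of a free diagram\<close>

lemma free_expand:
  "p = (\<Sum>x\<in>Poly_Mapping.keys p. free_scale (Poly_Mapping.lookup p x) (Poly_Mapping.single x 1))"
  by (rule trans[OF poly_mapping_eq_sum_single], rule sum.cong)
    (auto intro!: poly_mapping_eqI
      simp: lookup_pm_scale[OF vector_space_field] lookup_single when_def)

lemma free_space_eq_span:
  "free_space X = module.span free_scale ((\<lambda>x. Poly_Mapping.single x (1::'f::field)) ` X)"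
proof -
  interpret vector_space "free_scale :: 'f \<Rightarrow> ('a \<Rightarrow>\<^sub>0 'f) \<Rightarrow> _"
    by (rule vector_space_free)
  show ?thesis
  proof
    show "free_space X \<subseteq> span ((\<lambda>x. Poly_Mapping.single x (1::'f)) ` X)"
    proof
      fix p :: "'a \<Rightarrow>\<^sub>0 'f" assume "p \<in> free_space X"
      then show "p \<in> span ((\<lambda>x. Poly_Mapping.single x 1) ` X)"
        by (subst free_expand) (auto simp: free_space_def intro!: span_sum span_scale intro: span_base)
    qed
    have "subspace (free_space X)"
    proof (rule subspaceI)
      fix x y :: "'a \<Rightarrow>\<^sub>0 'f" assume "x \<in> free_space X" "y \<in> free_space X"
      then show "x + y \<in> free_space X"
        using keys_add[of x y] by (auto simp: free_space_def)
    qed (auto simp: free_space_def in_keys_iff lookup_pm_scale[OF vector_space_field])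
    then show "span ((\<lambda>x. Poly_Mapping.single x (1::'f)) ` X) \<subseteq> free_space X"
      by (intro span_minimal) (auto simp: free_space_def)
  qed
qed

lemma independent_singles:
  "\<not> module.dependent free_scale ((\<lambda>x. Poly_Mapping.single x (1::'f::field)) ` X)"
proof -
  interpret vector_space "free_scale :: 'f \<Rightarrow> ('a \<Rightarrow>\<^sub>0 'f) \<Rightarrow> _"
    by (rule vector_space_free)
  show ?thesis
    unfolding independent_explicit_module
  proof (intro allI impI)
    fix t :: "('a \<Rightarrow>\<^sub>0 'f) set" and u v
    assume t: "finite t" "t \<subseteq> (\<lambda>x. Poly_Mapping.single x 1) ` X" "v \<in> t"
      and 0: "(\<Sum>v\<in>t. free_scale (u v) v) = 0"
    obtain x where v: "v = Poly_Mapping.single x 1"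
      using t by auto
    \<comment> \<open>Distinct basis vectors have disjoint keys, so evaluation at \<open>x\<close>
      isolates the coefficient of \<open>v\<close>.\<close>
    have "0 = Poly_Mapping.lookup (\<Sum>v\<in>t. free_scale (u v) v) x"
      using 0 by simp
    also have "\<dots> = (\<Sum>w\<in>t. if w = v then u w else 0)"
      unfolding lookup_sum
    proof (intro sum.cong refl)
      fix w assume "w \<in> t"
      then obtain y where "w = Poly_Mapping.single y 1"
        using t by auto
      then show "Poly_Mapping.lookup (free_scale (u w) w) x = (if w = v then u w else 0)"
        by (auto simp: v lookup_pm_scale[OF vector_space_field] lookup_single when_def
            dest: arg_cong[of _ _ Poly_Mapping.keys])
    qed
    also have "\<dots> = u v"
      using t by simp
    finally show "u v = 0" by simp
  qed
qed

lemma linear_free_map: "Vector_Spaces.linear free_scale free_scale (free_map f)"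
  unfolding Vector_Spaces.linear_iff
  by (simp add: vector_space_free free_map_add free_map_scale)

section \<open>Comparison of the colimit with the free space on classes\<close>

text \<open>An element and its image lie in the same class, so the linearised maps to classes form a
  cocone, and the universal property applies.\<close>

lemma colim_vec_to_free:
  fixes M :: "('p::order, 'a) diagram"
  assumes M: "functor_to_finite_sets M"
  shows "\<exists>H. Vector_Spaces.linear (pm_scale (free_scale :: 'f::field \<Rightarrow> _)) free_scale H \<and>
    (\<forall>k\<in>I. \<forall>v\<in>free_space (Obj M k).
      H (colim_vec_in free_scale I (free_diagram M) k v) = free_map (colim_set_in I M k) v)"
proof -
  have Ms: "functor_to_sets M"
    using M by (simp add: functor_to_finite_sets_def)
  have G: "functor_to_Vec free_scale (free_diagram M :: ('p, 'a \<Rightarrow>\<^sub>0 'f) diagram)"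
    using free_diagram_functor_to_vec[OF M, where 'f = 'f] by (simp add: functor_to_vec_def)
  have "free_map (colim_set_in I M l) (free_map (Hom M k l) v) = free_map (colim_set_in I M k) v"
    if "k \<in> I" "l \<in> I" "k \<le> l" "v \<in> free_space (Obj M k)" for k l and v :: "'a \<Rightarrow>\<^sub>0 'f"
  proof -
    have "colim_set_in I M l (Hom M k l x) = colim_set_in I M k x" if "x \<in> Poly_Mapping.keys v" for x
      unfolding colim_set_in_eq_iff
      using colim_rel_Hom[OF Ms \<open>k \<in> I\<close> \<open>l \<in> I\<close> \<open>k \<le> l\<close>, of x] that \<open>v \<in> _\<close>
      by (intro equivclp_sym[OF r_into_equivclp]) (auto simp: free_space_def)
    then show ?thesis
      by (simp add: free_map_def[of "Hom M k l"] free_map_def[of "colim_set_in I M k"]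
          free_map_sum free_map_single)
  qed
  then show ?thesis
    using colim_vec_universal(1)[OF vector_space_free vector_space_free G, of I "\<lambda>k. free_map (colim_set_in I M k)"]
    by (simp add: free_diagram_def linear_on_def free_map_add free_map_scale)
qed

text \<open>A class is sent to the image of any representative; the choice does not matter because
  generating relations identify basis vectors in the colimit.\<close>

lemma free_to_colim_vec:
  fixes M :: "('p::order, 'a) diagram"
  assumes M: "functor_to_sets M"
  shows "\<exists>K. Vector_Spaces.linear (free_scale :: 'f::field \<Rightarrow> _) (pm_scale free_scale) K \<and>
    (\<forall>k\<in>I. \<forall>v\<in>free_space (Obj M k).
      K (free_map (colim_set_in I M k) v) = colim_vec_in free_scale I (free_diagram M) k v)"
proof -
  let ?G = "free_diagram M :: ('p, 'a \<Rightarrow>\<^sub>0 'f) diagram"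
  let ?\<iota> = "colim_vec_in free_scale I ?G"
  interpret pair: vector_space_pair "free_scale :: 'f \<Rightarrow> (('p \<times> 'a) set \<Rightarrow>\<^sub>0 'f) \<Rightarrow> _"
      "pm_scale (free_scale :: 'f \<Rightarrow> ('a \<Rightarrow>\<^sub>0 'f) \<Rightarrow> _) :: _ \<Rightarrow> ('p \<Rightarrow>\<^sub>0 _) \<Rightarrow> _"
    unfolding vector_space_pair_def using vector_space_free vector_space_pm_scale[OF vector_space_free] by blast
  interpret vpair: vector_space_pair "free_scale :: 'f \<Rightarrow> ('a \<Rightarrow>\<^sub>0 'f) \<Rightarrow> _"
      "pm_scale (free_scale :: 'f \<Rightarrow> ('a \<Rightarrow>\<^sub>0 'f) \<Rightarrow> _) :: _ \<Rightarrow> ('p \<Rightarrow>\<^sub>0 _) \<Rightarrow> _"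
    unfolding vector_space_pair_def using vector_space_free vector_space_pm_scale[OF vector_space_free] by blast
  have step: "?\<iota> (fst e) (Poly_Mapping.single (snd e) 1) = ?\<iota> (fst e') (Poly_Mapping.single (snd e') 1)"
    if "colim_rel I M e e'" for e e'
    using that colim_vec_in_compatible[OF vector_space_free, of "fst e" I "fst e'" "Poly_Mapping.single (snd e) 1" ?G]
    by (auto simp: colim_rel_def free_diagram_def free_map_single free_space_def)
  have equiv: "?\<iota> (fst e) (Poly_Mapping.single (snd e) 1) = ?\<iota> (fst e') (Poly_Mapping.single (snd e') 1)"
    if "equivclp (colim_rel I M) e e'" for e e'
    using that by (induction rule: equivclp_induct) (auto dest: step)
  define r where "r c = (SOME e. e \<in> c)" for c :: "('p \<times> 'a) set"
  let ?B = "range (\<lambda>c. Poly_Mapping.single c (1::'f)) :: (('p \<times> 'a) set \<Rightarrow>\<^sub>0 'f) set"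
  \<comment> \<open>\<open>THE\<close> recovers the class from its basis vector. A set that is not a
    class gets a default value.\<close>
  define K where "K = pair.construct ?B
    (\<lambda>b. let c = (THE c. b = Poly_Mapping.single c 1) in ?\<iota> (fst (r c)) (Poly_Mapping.single (snd (r c)) 1))"
  have linK: "Vector_Spaces.linear free_scale (pm_scale free_scale) K"
    unfolding K_def by (rule pair.linear_construct) (rule independent_singles)
  have K_single: "K (Poly_Mapping.single c 1) = ?\<iota> (fst (r c)) (Poly_Mapping.single (snd (r c)) 1)" for c
  proof -
    have "(THE c'. Poly_Mapping.single c (1::'f) = Poly_Mapping.single c' 1) = c"
      by (rule the_equality) (auto dest: arg_cong[of _ _ Poly_Mapping.keys])
    then show ?thesis
      unfolding K_def by (subst pair.construct_basis[OF independent_singles]) auto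
  qed
  have "K (free_map (colim_set_in I M k) v) = ?\<iota> k v" if "k \<in> I" "v \<in> free_space (Obj M k)" for k v
  proof -
    \<comment> \<open>Both sides are linear in \<open>v\<close>, so agreement on the basis vectors
      suffices.\<close>
    have "(K \<circ> free_map (colim_set_in I M k)) v = ?\<iota> k v"
    proof (rule vpair.linear_eq_on[OF _ linear_colim_vec_in[OF vector_space_free] that(2)[unfolded free_space_eq_span]])
      show "Vector_Spaces.linear free_scale (pm_scale free_scale) (K \<circ> free_map (colim_set_in I M k))"
        using linear_free_map linK by (rule Vector_Spaces.linear_compose)
      fix b assume "b \<in> (\<lambda>x. Poly_Mapping.single x (1::'f)) ` Obj M k"
      then obtain x where x: "b = Poly_Mapping.single x 1"
        by blast
      let ?c = "colim_set_in I M k x"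
      have "(k, x) \<in> ?c"
        by (simp add: colim_set_in_def)
      then have "r ?c \<in> ?c"
        unfolding r_def by (rule someI)
      then have "equivclp (colim_rel I M) (k, x) (r ?c)"
        by (simp add: colim_set_in_def)
      from equiv[OF this] show "(K \<circ> free_map (colim_set_in I M k)) b = ?\<iota> k b"
        by (simp add: x free_map_single K_single)
    qed
    then show ?thesis by simp
  qed
  then show ?thesis
    using linK by blast
qed

section \<open>Full components as a basis of the image\<close>

theorem proposition4p9:
  fixes M :: "(zz, 'a) diagram"
  assumes "functor_to_finite_sets M"
  shows "\<forall>I\<in>intervals.
    Full M I = rk_vec free_scale (free_diagram M :: (zz, 'a \<Rightarrow>\<^sub>0 'f::field) diagram) I"
proof
  fix I :: "zz set" assume I: "I \<in> intervals"
  let ?G = "free_diagram M :: (zz, 'a \<Rightarrow>\<^sub>0 'f) diagram"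
  let ?\<iota> = "colim_vec_in free_scale I ?G"
  let ?single = "\<lambda>c :: (zz \<times> 'a) set. Poly_Mapping.single c (1::'f)"
  obtain a where a: "a \<in> I"
    using I by (auto simp: intervals_def)
  have Ms: "functor_to_sets M"
    using assms by (simp add: functor_to_finite_sets_def)
  obtain H where linH: "Vector_Spaces.linear (pm_scale free_scale) free_scale H"
      and H: "\<And>k v. k \<in> I \<Longrightarrow> v \<in> free_space (Obj M k) \<Longrightarrow>
      H (?\<iota> k v) = free_map (colim_set_in I M k) v"
    using colim_vec_to_free[OF assms, where 'f = 'f and I = I] by blast
  obtain K where linK: "Vector_Spaces.linear free_scale (pm_scale free_scale) K"
      and K: "\<And>k v. k \<in> I \<Longrightarrow> v \<in> free_space (Obj M k) \<Longrightarrow>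
        K (free_map (colim_set_in I M k) v) = ?\<iota> k v"
    using free_to_colim_vec[OF Ms, where 'f = 'f and I = I] by blast
  interpret d: vector_space "pm_scale (free_scale :: 'f \<Rightarrow> ('a \<Rightarrow>\<^sub>0 'f) \<Rightarrow> _) :: _ \<Rightarrow> (zz \<Rightarrow>\<^sub>0 _) \<Rightarrow> _"
    by (rule vector_space_pm_scale) (rule vector_space_free)
  interpret K: Vector_Spaces.linear free_scale "pm_scale free_scale" K by fact
  have lim_obj: "x k \<in> free_space (Obj M k)" if "x \<in> lim_vec I ?G" "k \<in> I" for x k
    using that by (auto simp: lim_vec_def free_diagram_def)
  have canonical: "canonical_map free_scale I ?G x = K (free_map (colim_set_in I M k) (x k))"
    if "x \<in> lim_vec I ?G" "k \<in> I" for x k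
    using that canonical_map_eq[OF vector_space_free I that] lim_obj K by simp
  let ?full = "full_components I M"
  \<comment> \<open>A full component has an element over \<open>a\<close>, and \<open>K\<close> and
    \<open>H\<close> are known on its image.\<close>
  have HK: "H (K (?single c)) = ?single c" if c: "c \<in> ?full" for c
  proof -
    obtain x where x: "x \<in> Obj M a" "(a, x) \<in> c"
      using full_componentsD(2)[OF c a] by blast
    have "colim_set_in I M a x = c"
      unfolding colim_set_in_eq_class_iff[OF full_componentsD(1)[OF c]] by fact
    with x(1) have "K (?single c) = ?\<iota> a (Poly_Mapping.single x 1)"
      using K[OF a, of "Poly_Mapping.single x 1"] by (simp add: free_map_single free_space_def)
    then show ?thesis
      using H[OF a, of "Poly_Mapping.single x 1"] \<open>x \<in> Obj M a\<close> \<open>colim_set_in I M a x = c\<close>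
      by (simp add: free_map_single free_space_def)
  qed
  interpret pair: vector_space_pair "free_scale :: 'f \<Rightarrow> ((zz \<times> 'a) set \<Rightarrow>\<^sub>0 'f) \<Rightarrow> _"
      "free_scale :: 'f \<Rightarrow> ((zz \<times> 'a) set \<Rightarrow>\<^sub>0 'f) \<Rightarrow> _"
    unfolding vector_space_pair_def using vector_space_free by blast
  \<comment> \<open>\<open>H\<close> is a left inverse of \<open>K\<close> on this span, so
    \<open>K\<close> keeps the basis vectors of full components independent.\<close>
  have "(H \<circ> K) p = p" if "p \<in> module.span free_scale (?single ` ?full)" for p
    by (rule pair.linear_eq_on[OF Vector_Spaces.linear_compose[OF linK linH] vector_space.linear_ident[OF vector_space_free] that])
      (auto simp: HK)
  then have inj: "inj_on K (module.span free_scale (?single ` ?full))"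
    by (intro inj_on_inverseI) simp
  have indep: "d.independent (K ` ?single ` ?full)"
    by (rule K.independent_injective_image[OF independent_singles inj])
  have "inj_on (\<lambda>c. K (?single c)) ?full"
    using HK by (intro inj_onI) (metis keys_single singleton_inject one_neq_zero)
  then have card: "card (K ` ?single ` ?full) = Full M I"
    by (simp add: Full_def image_image card_image)
  have "d.dim (canonical_map free_scale I ?G ` lim_vec I ?G) = Full M I"
  proof (rule d.dim_unique[OF _ _ indep card])
    show "K ` ?single ` ?full \<subseteq> canonical_map free_scale I ?G ` lim_vec I ?G"
    proof clarify
      fix c assume "c \<in> ?full"
      \<comment> \<open>The section through \<open>c\<close> pushes forward to the basis vector
        \<open>c\<close>, so its canonical image is \<open>K\<close> of that vector.\<close>
      then obtain x where x: "x \<in> lim_vec I ?G"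
          "free_map (colim_set_in I M a) (x a) = ?single c"
        using full_component_lifts[OF assms _ a] by blast
      then show "K (?single c) \<in> canonical_map free_scale I ?G ` lim_vec I ?G"
        using canonical[OF x(1) a] by (intro image_eqI[OF _ x(1)]) simp
    qed
    show "canonical_map free_scale I ?G ` lim_vec I ?G \<subseteq> d.span (K ` ?single ` ?full)"
    proof clarify
      fix x assume x: "x \<in> lim_vec I ?G"
      define p where "p = free_map (colim_set_in I M a) (x a)"
      \<comment> \<open>The images of \<open>x a\<close> and \<open>x k\<close> in the colimit
        agree, and \<open>H\<close> turns them into the two pushforwards.\<close>
      have p: "p = free_map (colim_set_in I M k) (x k)" if "k \<in> I" for k
        unfolding p_def using H[OF a lim_obj[OF x a]] H[OF that lim_obj[OF x that]]
          canonical_map_eq[OF vector_space_free I x a] canonical_map_eq[OF vector_space_free I x that] by simp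
      have "c \<in> ?full" if "c \<in> Poly_Mapping.keys p" for c
      proof -
        \<comment> \<open>A key of \<open>p\<close> comes from an element over every index, hence
          its support is all of \<open>I\<close>.\<close>
        have *: "\<exists>z\<in>Obj M k. colim_set_in I M k z = c" if "k \<in> I" for k
          using \<open>c \<in> _\<close> keys_free_map[of "colim_set_in I M k" "x k"] lim_obj[OF x that]
          unfolding p[OF that] by (auto simp: free_space_def)
        then show ?thesis
          using a colim_set_in_mem[OF a, of _ M] by (auto simp: full_components_def supp_def)
      qed
      then have "p \<in> module.span free_scale (?single ` ?full)"
        by (auto simp: free_space_def simp flip: free_space_eq_span)
      then have "K p \<in> d.span (K ` ?single ` ?full)"
        by (simp add: K.span_image)
      then show "canonical_map free_scale I ?G x \<in> d.span (K ` ?single ` ?full)"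
        by (simp add: canonical[OF x a] p_def)
    qed
  qed
  then show "Full M I = rk_vec free_scale ?G I"
    by (simp add: rk_vec_def)
qed

end
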